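(* The image of the map $\theta:\tilde{\mathcal D}\to\mathcal A_\infty(\Delta)$, $\theta(f)=\frac{f_{zz}}{f_z}$, contains an open ball about the origin of $\mathcal A_\infty(\Delta)$.
   Context: $\Delta$ is the open unit disc. $\tilde{\mathcal D}$ is the set of univalent functions $f:\Delta\to\mathbb C$ with $f(0)=0$, $f'(0)=1$ which have a quasiconformal extension to $\mathbb C$. $\mathcal A_\infty(\Delta)$ is the Banach space of holomorphic $\psi$ on $\Delta$ with finite norm $\|\psi\|_{\infty,1}=\sup_{z\in\Delta}|\psi(z)(1-|z|^2)|$. *)

theory Defs
  imports "HOL-Complex_Analysis.Complex_Analysis" "HOL-Library.FuncSet"
begin

text \<open>
  A function on the unit disc is represented by a member of \<^term>\<open>extensional (ball 0 1)\<close>,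
  so that equality of functions is equality on the disc.
\<close>

abbreviation unit_disc :: "complex set" where
  "unit_disc \<equiv> ball 0 1"

text \<open>
  Absolute continuity on \<^term>\<open>{a..b}\<close> in the epsilon-delta form: a finite family of
  non-overlapping closed subintervals is a division of its union, and
  \<^term>\<open>K\<close> = \<^term>\<open>{Inf K..Sup K}\<close> for each member.
\<close>

definition absolutely_continuous_on_interval ::
    "real \<Rightarrow> real \<Rightarrow> (real \<Rightarrow> complex) \<Rightarrow> bool" where
  "absolutely_continuous_on_interval a b g \<longleftrightarrow>
     (\<forall>\<epsilon>>0. \<exists>\<delta>>0. \<forall>\<K> S. \<K> division_of S \<and> S \<subseteq> {a..b} \<and> (\<Sum>K\<in>\<K>. Sup K - Inf K) < \<delta>
        \<longrightarrow> (\<Sum>K\<in>\<K>. norm (g (Sup K) - g (Inf K))) < \<epsilon>)"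

text \<open>Absolute continuity on lines: for every closed rectangle with sides parallel to the axes,
  on almost every horizontal and almost every vertical segment of it.\<close>

definition ACL_on :: "complex set \<Rightarrow> (complex \<Rightarrow> complex) \<Rightarrow> bool" where
  "ACL_on \<Omega> F \<longleftrightarrow>
     (\<forall>a b. cbox a b \<subseteq> \<Omega> \<longrightarrow>
        (AE y in lebesgue. y \<in> {Im a..Im b} \<longrightarrow>
           absolutely_continuous_on_interval (Re a) (Re b) (\<lambda>x. F (Complex x y))) \<and>
        (AE x in lebesgue. x \<in> {Re a..Re b} \<longrightarrow>
           absolutely_continuous_on_interval (Im a) (Im b) (\<lambda>y. F (Complex x y))))"

definition has_partials_at :: "(complex \<Rightarrow> complex) \<Rightarrow> complex \<Rightarrow> bool" where
  "has_partials_at F z \<longleftrightarrow>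
     (\<lambda>x. F (Complex x (Im z))) differentiable (at (Re z)) \<and>
     (\<lambda>y. F (Complex (Re z) y)) differentiable (at (Im z))"

definition partial_x :: "(complex \<Rightarrow> complex) \<Rightarrow> complex \<Rightarrow> complex" where
  "partial_x F z = vector_derivative (\<lambda>x. F (Complex x (Im z))) (at (Re z))"

definition partial_y :: "(complex \<Rightarrow> complex) \<Rightarrow> complex \<Rightarrow> complex" where
  "partial_y F z = vector_derivative (\<lambda>y. F (Complex (Re z) y)) (at (Im z))"

definition d_z :: "(complex \<Rightarrow> complex) \<Rightarrow> complex \<Rightarrow> complex" where
  "d_z F z = (partial_x F z - \<i> * partial_y F z) / 2"

definition d_zbar :: "(complex \<Rightarrow> complex) \<Rightarrow> complex \<Rightarrow> complex" where
  "d_zbar F z = (partial_x F z + \<i> * partial_y F z) / 2"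

text \<open>
  The analytic definition, with \<^term>\<open>k = (K - 1) / (K + 1)\<close> for the usual dilatation bound
  \<^term>\<open>K \<ge> 1\<close>.  A map satisfying it preserves orientation, since the Jacobian is
  \<^term>\<open>(norm (d_z F z))\<^sup>2 - (norm (d_zbar F z))\<^sup>2\<close>.
\<close>

definition quasiconformal :: "complex set \<Rightarrow> complex set \<Rightarrow> (complex \<Rightarrow> complex) \<Rightarrow> bool" where
  "quasiconformal \<Omega> \<Omega>' F \<longleftrightarrow>
     open \<Omega> \<and> open \<Omega>' \<and> (\<exists>G. homeomorphism \<Omega> \<Omega>' F G) \<and> ACL_on \<Omega> F \<and>
     (\<exists>k. 0 \<le> k \<and> k < 1 \<and>
        (AE z in lebesgue. z \<in> \<Omega> \<longrightarrow>
           has_partials_at F z \<and> norm (d_zbar F z) \<le> k * norm (d_z F z)))"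

definition D_tilde :: "(complex \<Rightarrow> complex) set" where
  "D_tilde =
     {f \<in> extensional unit_disc.
        f holomorphic_on unit_disc \<and> inj_on f unit_disc \<and> f 0 = 0 \<and> deriv f 0 = 1 \<and>
        (\<exists>F. quasiconformal UNIV UNIV F \<and> (\<forall>z\<in>unit_disc. F z = f z))}"

definition A_inf :: "(complex \<Rightarrow> complex) set" where
  "A_inf =
     {\<psi> \<in> extensional unit_disc.
        \<psi> holomorphic_on unit_disc \<and>
        bdd_above ((\<lambda>z. norm (\<psi> z * of_real (1 - (norm z)\<^sup>2))) ` unit_disc)}"

definition A_inf_norm :: "(complex \<Rightarrow> complex) \<Rightarrow> real" where
  "A_inf_norm \<psi> = (SUP z\<in>unit_disc. norm (\<psi> z * of_real (1 - (norm z)\<^sup>2)))"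

definition A_inf_ball :: "real \<Rightarrow> (complex \<Rightarrow> complex) set" where
  "A_inf_ball r = {\<psi> \<in> A_inf. A_inf_norm \<psi> < r}"

definition theta :: "(complex \<Rightarrow> complex) \<Rightarrow> complex \<Rightarrow> complex" where
  "theta f = restrict (\<lambda>z. deriv (deriv f) z / deriv f z) unit_disc"

end

theory Submission
  imports Defs
begin

text \<open>
  Integrating twice gives \<open>f\<close> with \<open>f' = exp g\<close> and \<open>g' = \<psi>\<close>.  If \<open>\<psi>\<close> has norm at most \<open>r\<close>, then
  \<open>g\<close> varies by at most a multiple of \<open>r\<close> over hyperbolically bounded distances, so \<open>f\<close> is affine up
  to a relative error \<open>O(r)\<close> at every scale: around a point \<open>p\<close> it is
  \<open>f p + f' p * (z - p)\<close> on the part of the closed disc at distance \<open>O(1 - norm p)\<close>.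
  Becker's extension \<open>F w = f \<zeta> + (w - \<zeta>) * f' \<zeta>\<close>, where \<open>\<zeta> = 1 / cnj w\<close> for \<open>norm w > 1\<close>, inherits
  this approximation.  Any two points of the plane fit into one such region, apart from pairs that
  are close together compared with their distance to the circle, which are handled directly; this
  makes \<open>F\<close> injective and continuous.  It is onto because \<open>F w - w\<close> is bounded.  Off the circle \<open>F\<close>
  is smooth with dilatation at most \<open>r\<close> and derivative
  \<open>O(\<bar>1 - norm w\<bar> powr (- 1 / 2))\<close> locally, which is integrable along all but two lines in each
  direction.
\<close>

subsection \<open>Absolute continuity\<close>

text \<open>Cut \<open>h\<close> at a height \<open>n\<close> for which the discarded part has
  integral below \<open>\<epsilon> / 2\<close>. Over a family of total length below
  \<open>\<delta>\<close> the truncated part contributes at most \<open>n * \<delta>\<close>, and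
  the discarded part at most its integral over the whole interval.\<close>

lemma absolutely_continuous_on_interval_integral_bound:
  fixes h :: "real \<Rightarrow> real"
  assumes h: "h integrable_on {a..b}" and nonneg: "\<And>x. 0 \<le> h x"
    and bound: "\<And>u v. a \<le> u \<Longrightarrow> u \<le> v \<Longrightarrow> v \<le> b \<Longrightarrow> norm (g v - g u) \<le> integral {u..v} h"
  shows "absolutely_continuous_on_interval a b g"
  unfolding absolutely_continuous_on_interval_def
proof (intro allI impI)
  fix \<epsilon> :: real assume "\<epsilon> > 0"
  define m where "m n x = min (h x) (real n)" for n x
  have absint: "h absolutely_integrable_on {a..b}"
    using h nonneg by (simp add: nonnegative_absolutely_integrable_1)
  have m_int: "m n integrable_on {a..b}" for n
    unfolding m_def
    by (intro set_lebesgue_integral_eq_integral(1) absolutely_integrable_min_1 absint) auto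
  have "(\<lambda>n. integral {a..b} (m n)) \<longlonglongrightarrow> integral {a..b} h"
  proof (rule dominated_convergence(2)[where h = h])
    fix x
    have "eventually (\<lambda>n. m n x = h x) sequentially"
      using eventually_ge_at_top[of "nat \<lceil>h x\<rceil>"]
      by eventually_elim (auto simp: m_def min_def nat_le_iff ceiling_le_iff)
    then show "(\<lambda>n. m n x) \<longlonglongrightarrow> h x"
      by (rule tendsto_eventually)
  qed (use m_int h nonneg in \<open>auto simp: m_def\<close>)
  then have "eventually (\<lambda>n. integral {a..b} h - integral {a..b} (m n) < \<epsilon> / 2) sequentially"
    using \<open>\<epsilon> > 0\<close> by (intro order_tendstoD(2)[of _ 0]) (auto intro!: tendsto_eq_intros)
  then obtain n where n: "integral {a..b} h - integral {a..b} (m n) < \<epsilon> / 2"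
    using eventually_happens'[OF sequentially_bot] by blast
  define \<delta> where "\<delta> = \<epsilon> / 2 / (real n + 1)"
  have "\<delta> > 0" using \<open>\<epsilon> > 0\<close> by (simp add: \<delta>_def)
  moreover have "(\<Sum>K\<in>\<K>. norm (g (Sup K) - g (Inf K))) < \<epsilon>"
    if K: "\<K> division_of S" "S \<subseteq> {a..b}" "(\<Sum>K\<in>\<K>. Sup K - Inf K) < \<delta>" for \<K> S
  proof -
    define r where "r x = h x - m n x" for x
    have r_int: "r integrable_on {a..b}" and r0: "\<And>x. 0 \<le> r x"
      unfolding r_def using integrable_diff[OF h m_int[of n]] by (auto simp: m_def)
    have piece: "norm (g (Sup K) - g (Inf K)) \<le> real n * (Sup K - Inf K) + integral K r" if KK: "K \<in> \<K>" for K
    proof -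
      have "K \<noteq> {}" "K \<subseteq> {a..b}"
        using division_ofD(2,3)[OF K(1) KK] K(2) by auto
      moreover obtain u v where "K = {u..v}"
        using division_ofD(4)[OF K(1) KK] by (auto simp: cbox_interval)
      ultimately have uv: "K = {u..v}" "K \<noteq> {}" "K \<subseteq> {a..b}" by auto
      then have le: "a \<le> u" "u \<le> v" "v \<le> b" by auto
      have sub: "{u..v} \<subseteq> {a..b}" using uv by auto
      have ints: "m n integrable_on {u..v}" "r integrable_on {u..v}"
        using integrable_on_subinterval[OF m_int sub] integrable_on_subinterval[OF r_int sub] by auto
      have "norm (g v - g u) \<le> integral {u..v} (\<lambda>x. m n x + r x)"
        using bound[OF le] by (simp add: r_def)
      also have "\<dots> = integral {u..v} (m n) + integral {u..v} r"
        by (rule Henstock_Kurzweil_Integration.integral_add[OF ints])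
      also have "integral {u..v} (m n) \<le> integral {u..v} (\<lambda>x. real n)"
        by (intro integral_le ints) (auto simp: m_def)
      finally show ?thesis using le by (simp add: uv(1) mult.commute)
    qed
    have rS: "r integrable_on S"
    proof -
      have "(r has_integral integral K r) K" if KK: "K \<in> \<K>" for K
      proof -
        obtain u v where "K = cbox u v" using division_ofD(4)[OF K(1) KK] by blast
        moreover have "K \<subseteq> {a..b}" using division_ofD(2)[OF K(1) KK] K(2) by blast
        ultimately show ?thesis
          using integrable_on_subinterval[OF r_int, of u v] by (auto simp: cbox_interval integrable_integral)
      qed
      from has_integral_combine_division[OF K(1) this] show ?thesis by blast
    qed
    have "(\<Sum>K\<in>\<K>. norm (g (Sup K) - g (Inf K)))
        \<le> (\<Sum>K\<in>\<K>. real n * (Sup K - Inf K) + integral K r)"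
      by (rule sum_mono) (rule piece)
    also have "\<dots> = real n * (\<Sum>K\<in>\<K>. Sup K - Inf K) + integral S r"
      by (simp add: sum.distrib sum_distrib_left integral_combine_division_topdown[OF rS K(1)])
    also have "integral S r \<le> integral {a..b} r"
      by (rule integral_subset_le[OF K(2) rS r_int]) (simp add: r0)
    also have "integral {a..b} r < \<epsilon> / 2"
      unfolding r_def using n Henstock_Kurzweil_Integration.integral_diff[OF h m_int[of n]] by simp
    also have "real n * (\<Sum>K\<in>\<K>. Sup K - Inf K) \<le> real n * \<delta>"
      by (rule mult_left_mono[OF less_imp_le[OF K(3)]]) simp
    also have "real n * \<delta> \<le> \<epsilon> / 2"
    proof -
      have "real n * \<delta> \<le> (real n + 1) * \<delta>"
        using \<open>\<delta> > 0\<close> by (intro mult_right_mono) auto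
      also have "\<dots> = \<epsilon> / 2"
        using nonzero_eq_divide_eq[of "real n + 1" \<delta> "\<epsilon> / 2"] \<delta>_def by (simp add: mult.commute)
      finally show ?thesis .
    qed
    finally show ?thesis by simp
  qed
  ultimately show "\<exists>\<delta>>0. \<forall>\<K> S. \<K> division_of S \<and> S \<subseteq> {a..b} \<and> (\<Sum>K\<in>\<K>. Sup K - Inf K) < \<delta>
        \<longrightarrow> (\<Sum>K\<in>\<K>. norm (g (Sup K) - g (Inf K))) < \<epsilon>" by blast
qed

lemma integrable_inverse_sqrt_abs:
  fixes a b s :: real
  shows "(\<lambda>x. 1 / sqrt \<bar>x - s\<bar>) integrable_on {a..b}"
proof (cases "a \<le> b")
  case True
  \<comment> \<open>The library's square root is odd, so this is an antiderivative on both sides of the singularity.\<close>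
  have "((\<lambda>x. 1 / sqrt \<bar>x - s\<bar>) has_integral (2 * sqrt (b - s) - 2 * sqrt (a - s))) {a..b}"
  proof (rule fundamental_theorem_of_calculus_interior_strong[where S = "{s}"])
    fix x assume "x \<in> {a<..<b} - {s}"
    then consider "x < s" | "x > s" by fastforce
    then have "((\<lambda>x. 2 * sqrt (x - s)) has_field_derivative 1 / sqrt \<bar>x - s\<bar>) (at x)"
    proof cases
      case 1
      have "((\<lambda>x. - 2 * sqrt (s - x)) has_field_derivative 1 / sqrt (s - x)) (at x)"
        using 1 by (rule_tac derivative_eq_intros refl | simp add: field_simps)+
      moreover have "(\<lambda>x. - 2 * sqrt (s - x)) = (\<lambda>x. 2 * sqrt (x - s))"
        using real_sqrt_minus[of "x - s" for x] by (simp add: fun_eq_iff)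
      moreover have "\<bar>x - s\<bar> = s - x" using 1 by simp
      ultimately show ?thesis by simp
    next
      case 2
      then show ?thesis by (rule_tac derivative_eq_intros refl | simp add: field_simps)+
    qed
    then show "((\<lambda>x. 2 * sqrt (x - s)) has_vector_derivative 1 / sqrt \<bar>x - s\<bar>) (at x)"
      by (simp add: has_real_derivative_iff_has_vector_derivative)
  qed (use True in \<open>auto intro!: continuous_intros\<close>)
  then show ?thesis by blast
qed auto

text \<open>For \<open>c = s\<^sup>2\<close> the quantity under the root factors as
  \<open>\<bar>x - s\<bar> * \<bar>x + s\<bar>\<close>. One factor is at least \<open>s\<close>, and
  the other leaves an integrable inverse square root. With \<open>c = 0\<close> the bound would be a
  multiple of \<open>1 / \<bar>x\<bar>\<close>, which is not integrable across 0.\<close>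

lemma absolutely_continuous_on_interval_sqrt_singularity:
  fixes G :: "real \<Rightarrow> complex"
  assumes cont: "continuous_on {a..b} G" and "c \<noteq> 0" "C \<ge> 0"
    and deriv: "\<And>x. x \<in> {a..b} \<Longrightarrow> x\<^sup>2 \<noteq> c \<Longrightarrow> (G has_vector_derivative G' x) (at x)"
    and bound: "\<And>x. x \<in> {a..b} \<Longrightarrow> x\<^sup>2 \<noteq> c \<Longrightarrow> norm (G' x) \<le> C / sqrt \<bar>x\<^sup>2 - c\<bar>"
  shows "absolutely_continuous_on_interval a b G"
proof -
  define s where "s = sqrt \<bar>c\<bar>"
  have s: "s > 0" using \<open>c \<noteq> 0\<close> by (simp add: s_def)
  \<comment> \<open>The first summand multiplies out to \<open>C / s\<close> and serves
    \<open>c < 0\<close>, where \<open>x\<^sup>2 - c\<close> is at least \<open>s\<^sup>2\<close>.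
    The other two serve \<open>c > 0\<close>.\<close>
  define h where "h x = C / sqrt s * (1 / s * sqrt s + (1 / sqrt \<bar>x - s\<bar> + 1 / sqrt \<bar>x - (- s)\<bar>))" for x
  have h_int: "h integrable_on {u..v}" for u v
    unfolding h_def
    by (intro integrable_on_mult_right integrable_add integrable_inverse_sqrt_abs integrable_const_ivl)
  have h0: "0 \<le> h x" for x using s \<open>C \<ge> 0\<close> by (simp add: h_def)
  have sing: "1 / sqrt \<bar>x\<^sup>2 - c\<bar> \<le> 1 / sqrt s * (1 / s * sqrt s + (1 / sqrt \<bar>x - s\<bar> + 1 / sqrt \<bar>x - (- s)\<bar>))"
    if "x\<^sup>2 \<noteq> c" for x
  proof (cases "c < 0")
    case True
    then have "s\<^sup>2 = - c" by (simp add: s_def)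
    then have "s \<le> sqrt \<bar>x\<^sup>2 - c\<bar>"
      using s True zero_le_power2[of x] by (intro real_le_rsqrt) linarith
    then have "1 / sqrt \<bar>x\<^sup>2 - c\<bar> \<le> 1 / s" using s by (intro frac_le) auto
    also have "\<dots> \<le> 1 / sqrt s * (1 / s * sqrt s + (1 / sqrt \<bar>x - s\<bar> + 1 / sqrt \<bar>x - (- s)\<bar>))"
      using s by (simp add: distrib_left)
    finally show ?thesis .
  next
    case False
    then have c: "c = s\<^sup>2" by (simp add: s_def)
    have eq: "\<bar>x\<^sup>2 - c\<bar> = \<bar>x - s\<bar> * \<bar>x - (- s)\<bar>"
      by (simp add: c power2_eq_square abs_mult[symmetric] algebra_simps)
    have ne: "x \<noteq> s" "x \<noteq> - s" using that c by auto
    have key: "1 / (sqrt p * sqrt q) \<le> 1 / sqrt s * (1 / s * sqrt s + (1 / sqrt p + 1 / sqrt q))"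
      if "p > 0" "q > 0" "s \<le> p" for p q
    proof -
      have "1 / (sqrt p * sqrt q) \<le> 1 / (sqrt s * sqrt q)"
        using that s by (intro divide_left_mono mult_right_mono) auto
      also have "\<dots> \<le> 1 / sqrt s * (1 / s * sqrt s + (1 / sqrt p + 1 / sqrt q))"
        using s that by (simp add: distrib_left)
      finally show ?thesis .
    qed
    have "s \<le> \<bar>x - s\<bar> \<or> s \<le> \<bar>x - (- s)\<bar>" using s by arith
    then show ?thesis
    proof
      assume "s \<le> \<bar>x - s\<bar>"
      with key[of "\<bar>x - s\<bar>" "\<bar>x - (- s)\<bar>"] ne show ?thesis
        by (simp add: eq real_sqrt_mult)
    next
      assume "s \<le> \<bar>x - (- s)\<bar>"
      with key[of "\<bar>x - (- s)\<bar>" "\<bar>x - s\<bar>"] ne show ?thesis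
        unfolding eq real_sqrt_mult by (simp add: ac_simps)
    qed
  qed
  have fin: "finite {x::real. x\<^sup>2 = c}"
  proof (rule finite_subset)
    show "{x. x\<^sup>2 = c} \<subseteq> {s, - s}"
      using power2_eq_iff by (fastforce simp: s_def)
  qed auto
  \<comment> \<open>\<open>G'\<close> is unconstrained at the singular points. With the value 0
    there, \<open>H\<close> is dominated by \<open>h\<close> everywhere, and the fundamental theorem
    tolerates the finite exceptional set.\<close>
  define H where "H x = (if x\<^sup>2 = c then 0 else G' x)" for x
  show ?thesis
  proof (rule absolutely_continuous_on_interval_integral_bound[OF h_int h0])
    fix u v assume uv: "a \<le> u" "u \<le> v" "v \<le> b"
    have "(H has_integral (G v - G u)) {u..v}"
    proof (rule fundamental_theorem_of_calculus_interior_strong[OF fin uv(2)])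
      show "continuous_on {u..v} G" using cont by (rule continuous_on_subset) (use uv in auto)
      fix x assume "x \<in> {u<..<v} - {x. x\<^sup>2 = c}"
      then show "(G has_vector_derivative H x) (at x)" using deriv[of x] uv by (simp add: H_def)
    qed
    moreover have "norm (H x) \<le> h x" if "x \<in> {u..v}" for x
    proof (cases "x\<^sup>2 = c")
      case False
      then have "norm (H x) \<le> C * (1 / sqrt \<bar>x\<^sup>2 - c\<bar>)"
        using bound[of x] that uv by (simp add: H_def)
      also have "\<dots> \<le> C * (1 / sqrt s * (1 / s * sqrt s + (1 / sqrt \<bar>x - s\<bar> + 1 / sqrt \<bar>x - (- s)\<bar>)))"
        by (rule mult_left_mono[OF sing[OF False] \<open>C \<ge> 0\<close>])
      finally show ?thesis by (simp add: h_def)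
    qed (simp add: H_def h0)
    ultimately show "norm (G v - G u) \<le> integral {u..v} h"
      using Henstock_Kurzweil_Integration.integral_norm_bound_integral[OF _ h_int, of H u v]
      by (metis has_integral_iff)
  qed
qed

text \<open>Every real-linear map of the plane has the form \<open>a * v + b * cnj v\<close>. Its
  values at 1 and \<open>\<i>\<close> are the two partials, and solving for \<open>a\<close> and
  \<open>b\<close> gives the Wirtinger derivatives. The last two conclusions feed the absolute
  continuity on lines.\<close>

lemma partials_at:
  assumes "(F has_derivative (\<lambda>v. a * v + b * cnj v)) (at z)"
  shows "has_partials_at F z" "d_z F z = a" "d_zbar F z = b"
    and "((\<lambda>x. F (Complex x (Im z))) has_vector_derivative a + b) (at (Re z))"
    and "((\<lambda>y. F (Complex (Re z) y)) has_vector_derivative \<i> * (a - b)) (at (Im z))"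
proof -
  have lin: "(\<lambda>x. Complex x (Im z)) = (\<lambda>x. of_real x + \<i> * of_real (Im z))"
    "(\<lambda>y. Complex (Re z) y) = (\<lambda>y. of_real (Re z) + \<i> * of_real y)"
    by (simp_all add: fun_eq_iff complex_eq_iff)
  have dx: "((\<lambda>x. Complex x (Im z)) has_derivative (\<lambda>t. of_real t)) (at (Re z))"
    unfolding lin by (rule derivative_eq_intros refl | simp)+
  have dy: "((\<lambda>y. Complex (Re z) y) has_derivative (\<lambda>t. \<i> * of_real t)) (at (Im z))"
    unfolding lin by (rule derivative_eq_intros refl | simp)+
  show x: "((\<lambda>x. F (Complex x (Im z))) has_vector_derivative a + b) (at (Re z))"
    unfolding has_vector_derivative_def
    using has_derivative_compose[OF dx, of F "\<lambda>v. a * v + b * cnj v"] assms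
    by (simp add: algebra_simps scaleR_conv_of_real)
  show y: "((\<lambda>y. F (Complex (Re z) y)) has_vector_derivative \<i> * (a - b)) (at (Im z))"
    unfolding has_vector_derivative_def
    using has_derivative_compose[OF dy, of F "\<lambda>v. a * v + b * cnj v"] assms
    by (simp add: algebra_simps scaleR_conv_of_real)
  show "has_partials_at F z"
    unfolding has_partials_at_def using x y differentiableI_vector by blast
  have px: "partial_x F z = a + b" and py: "partial_y F z = \<i> * (a - b)"
    unfolding partial_x_def partial_y_def using x y by (auto intro: vector_derivative_at)
  show "d_z F z = a" "d_zbar F z = b"
    by (auto simp: d_z_def d_zbar_def px py mult.assoc[symmetric])
qed

subsection \<open>Affine approximation in the disc\<close>

text \<open>\<open>norm (exp (g p))\<close> is the scale factor in the estimates below and should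
  not be rewritten in terms of \<open>Re (g p)\<close>.\<close>

declare norm_exp_eq_Re [simp del]

lemma has_vector_derivative_line:
  fixes p w :: complex
  shows "((\<lambda>t. p + of_real t * w) has_vector_derivative w) (at s)"
  unfolding has_vector_derivative_def
  by (auto intro!: derivative_eq_intros simp: scaleR_conv_of_real)

text \<open>Along the segment from 0 to \<open>z\<close> the derivative of \<open>exp\<close> is
  dominated by that of the real function \<open>exp (t * norm z)\<close>.\<close>

lemma norm_exp_minus_1_le:
  fixes z :: complex
  shows "norm (exp z - 1) \<le> exp (norm z) - 1"
proof -
  have "norm (exp (of_real 1 * z) - exp (of_real 0 * z)) \<le> exp (1 * norm z) - exp (0 * norm z)"
  proof (rule differentiable_bound_general[where f = "\<lambda>t. exp (of_real t * z)"
        and \<phi> = "\<lambda>t. exp (t * norm z)" and f' = "\<lambda>t. z * exp (of_real t * z)"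
        and \<phi>' = "\<lambda>t. norm z * exp (t * norm z)"])
    fix t :: real assume t: "0 < t" "t < 1"
    show "((\<lambda>t. exp (of_real t * z)) has_vector_derivative z * exp (of_real t * z)) (at t)"
      using field_vector_diff_chain_at[OF has_vector_derivative_line[of 0 z t] DERIV_exp] by (simp add: o_def)
    show "((\<lambda>t. exp (t * norm z)) has_vector_derivative norm z * exp (t * norm z)) (at t)"
      by (auto simp: has_real_derivative_iff_has_vector_derivative[symmetric] intro!: derivative_eq_intros)
    have "norm (exp (of_real t * z)) \<le> exp (norm (of_real t * z))" by (rule norm_exp)
    also have "norm (of_real t * z) = t * norm z" using t by (simp add: norm_mult)
    finally show "norm (z * exp (of_real t * z)) \<le> norm z * exp (t * norm z)"
      unfolding norm_mult by (rule mult_left_mono) simp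
  qed (auto intro!: continuous_intros)
  then show ?thesis by simp
qed

lemma norm_diff_linear_combine:
  fixes A :: complex
  assumes "norm (X1 - Y - A * (w1 - p)) \<le> e1" "norm (X2 - Y - A * (w2 - p)) \<le> e2"
  shows "norm (X1 - X2 - A * (w1 - w2)) \<le> e1 + e2"
proof -
  have "X1 - X2 - A * (w1 - w2) = (X1 - Y - A * (w1 - p)) - (X2 - Y - A * (w2 - p))"
    by (simp add: algebra_simps)
  then show ?thesis using norm_triangle_ineq4 assms by (metis (no_types) add_mono order_trans)
qed

text \<open>Here \<open>g\<close> is the branch of the logarithm of the derivative of
  \<open>f\<close> that vanishes at 0, so \<open>g'\<close> is the quotient of the second derivative
  of \<open>f\<close> by the first. The bound 1/4000 is set by
  \<open>near_circle_difference\<close>, where the relative error \<open>1704 * r\<close> must not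
  exceed 1/2.\<close>

locale bloch_primitive =
  fixes f g g' :: "complex \<Rightarrow> complex" and r :: real
  assumes r: "0 < r" "r \<le> 1 / 4000"
    and deriv_f: "\<And>z. norm z < 1 \<Longrightarrow> (f has_field_derivative exp (g z)) (at z)"
    and deriv_g: "\<And>z. norm z < 1 \<Longrightarrow> (g has_field_derivative g' z) (at z)"
    and bloch: "\<And>z. norm z < 1 \<Longrightarrow> norm (g' z) * (1 - (norm z)\<^sup>2) \<le> r"
    and g_0: "g 0 = 0"
begin

lemma norm_g'_le:
  assumes "norm z < 1" shows "norm (g' z) \<le> r / (1 - norm z)"
proof -
  have "norm (g' z) * (1 - norm z) \<le> norm (g' z) * (1 - (norm z)\<^sup>2)"
    using assms by (intro mult_left_mono) (auto simp: power2_eq_square mult_left_le)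
  with bloch[OF assms] show ?thesis using assms by (simp add: pos_le_divide_eq)
qed

lemma segment_depth:
  fixes p z :: complex
  assumes "norm z \<le> 1" "0 \<le> t" "t \<le> 1"
  shows "(1 - t) * (1 - norm p) \<le> 1 - norm (p + of_real t * (z - p))"
proof -
  have "norm (p + of_real t * (z - p)) = norm (of_real (1 - t) * p + of_real t * z)"
    by (simp add: algebra_simps)
  also have "\<dots> \<le> norm (of_real (1 - t) * p) + norm (of_real t * z)" by (rule norm_triangle_ineq)
  also have "\<dots> = (1 - t) * norm p + t * norm z" using assms by (simp add: norm_mult del: of_real_diff)
  also have "\<dots> \<le> (1 - t) * norm p + t" using assms by (simp add: mult_left_le)
  finally show ?thesis by (simp add: algebra_simps)
qed

lemma segment_in_disc:
  fixes p z :: complex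
  assumes "norm p < 1" "norm z \<le> 1" "0 \<le> t" "t < 1"
  shows "norm (p + of_real t * (z - p)) < 1"
proof -
  have "0 < (1 - t) * (1 - norm p)" using assms by simp
  with segment_depth[of z t p] assms show ?thesis by linarith
qed

text \<open>By \<open>segment_depth\<close> the bound on \<open>g'\<close> along the segment is a
  multiple of \<open>1 / (1 - t)\<close>, whose integral is a logarithm. The endpoint
  \<open>z\<close> may lie on the circle, hence the restriction \<open>t < 1\<close>.\<close>

lemma g_along_segment:
  assumes p: "norm p < 1" and z: "norm z \<le> 1" and t: "0 \<le> t" "t < 1"
  shows "norm (g (p + of_real t * (z - p)) - g p) \<le> - (r * norm (z - p) / (1 - norm p)) * ln (1 - t)"
proof (cases "t = 0")
  case False
  with t have "0 < t" by simp
  define k where "k = r * norm (z - p) / (1 - norm p)"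
  have "norm (g (p + of_real t * (z - p)) - g (p + of_real 0 * (z - p))) \<le> - k * ln (1 - t) - (- k * ln (1 - 0))"
  proof (rule differentiable_bound_general[where f = "\<lambda>t. g (p + of_real t * (z - p))"
        and \<phi> = "\<lambda>t. - k * ln (1 - t)" and f' = "\<lambda>t. (z - p) * g' (p + of_real t * (z - p))"
        and \<phi>' = "\<lambda>t. k / (1 - t)", OF \<open>0 < t\<close>])
    have d: "((\<lambda>t. g (p + of_real t * (z - p))) has_vector_derivative (z - p) * g' (p + of_real s * (z - p))) (at s)"
      if "0 \<le> s" "s \<le> t" for s
      using field_vector_diff_chain_at[OF has_vector_derivative_line deriv_g[OF segment_in_disc[OF p z, of s]]] that t
      by (simp add: o_def)
    then show "continuous_on {0..t} (\<lambda>t. g (p + of_real t * (z - p)))"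
      by (intro continuous_at_imp_continuous_on ballI) (auto dest!: has_vector_derivative_continuous)
    show "continuous_on {0..t} (\<lambda>t. - k * ln (1 - t))"
      using t by (auto intro!: continuous_intros)
    fix s assume s: "0 < s" "s < t"
    show "((\<lambda>t. g (p + of_real t * (z - p))) has_vector_derivative (z - p) * g' (p + of_real s * (z - p))) (at s)"
      using d s by simp
    have "((\<lambda>t. - k * ln (1 - t)) has_field_derivative k / (1 - s)) (at s)"
      using s t by (rule_tac derivative_eq_intros refl | simp)+
    then show "((\<lambda>t. - k * ln (1 - t)) has_vector_derivative k / (1 - s)) (at s)"
      by (simp add: has_real_derivative_iff_has_vector_derivative)
    have pos: "0 < (1 - s) * (1 - norm p)" using s t p by simp
    have "norm (g' (p + of_real s * (z - p))) \<le> r / (1 - norm (p + of_real s * (z - p)))"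
      using segment_in_disc[OF p z] s t by (intro norm_g'_le) auto
    also have "\<dots> \<le> r / ((1 - s) * (1 - norm p))"
      using segment_depth[OF z, of s p] s t r pos by (intro frac_le) auto
    finally have "norm (z - p) * norm (g' (p + of_real s * (z - p))) \<le> norm (z - p) * (r / ((1 - s) * (1 - norm p)))"
      by (rule mult_left_mono) simp
    also have "\<dots> = k / (1 - s)" by (simp add: k_def mult.commute)
    finally show "norm ((z - p) * g' (p + of_real s * (z - p))) \<le> k / (1 - s)" by (simp add: norm_mult)
  qed
  then show ?thesis by (simp add: k_def)
qed simp

text \<open>Exponentiating the logarithmic bound gives a power of \<open>1 - t\<close> whose
  exponent is proportional to \<open>r\<close>. For small \<open>r\<close> it is integrable up to
  \<open>t = 1\<close>.\<close>

lemma exp_g_along_segment: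
  assumes p: "norm p < 1" and z: "norm z \<le> 1" and t: "0 \<le> t" "t < 1"
  shows "norm (exp (g (p + of_real t * (z - p))) - exp (g p))
    \<le> norm (exp (g p)) * ((1 - t) powr (- (r * norm (z - p) / (1 - norm p))) - 1)"
proof -
  define k where "k = r * norm (z - p) / (1 - norm p)"
  define D where "D = g (p + of_real t * (z - p)) - g p"
  have "norm D \<le> - k * ln (1 - t)" unfolding D_def k_def by (rule g_along_segment[OF assms])
  then have "exp (norm D) \<le> (1 - t) powr (- k)" using t by (simp add: powr_def)
  moreover have "exp (g (p + of_real t * (z - p))) - exp (g p) = exp (g p) * (exp D - 1)"
    by (simp add: D_def exp_diff algebra_simps)
  ultimately show ?thesis
    using norm_exp_minus_1_le[of D] by (auto simp: norm_mult k_def[symmetric] intro!: mult_left_mono)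
qed

text \<open>The depth \<^term>\<open>1 - norm (p + of_real t * (z - p))\<close> decreases at most linearly along a segment, so
  the possible blow-up of \<^term>\<open>exp \<circ> g\<close> at a boundary endpoint is integrable.\<close>

lemma affine_approximation:
  assumes p: "norm p < 1" and z: "norm z \<le> 1" and near: "norm (z - p) \<le> 12 * (1 - norm p)"
    and cont: "continuous_on (closed_segment p z) f"
  shows "norm (f z - f p - exp (g p) * (z - p)) \<le> 24 * r * norm (exp (g p)) * norm (z - p)"
proof -
  define k where "k = r * norm (z - p) / (1 - norm p)"
  define A where "A = exp (g p)"
  define N where "N = norm (z - p) * norm A"
  have "k = r * (norm (z - p) / (1 - norm p))" by (simp add: k_def)
  also have "\<dots> \<le> r * 12" using r near p by (intro mult_left_mono) (auto simp: pos_divide_le_eq)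
  finally have k12: "k \<le> 12 * r" by simp
  then have k: "k \<le> 1 / 2" using r by simp
  have k0: "0 \<le> k" using r p by (simp add: k_def)
  have N0: "0 \<le> N" by (simp add: N_def)
  define \<gamma> where "\<gamma> t = p + of_real t * (z - p)" for t
  \<comment> \<open>The comparison function is an antiderivative of
    \<open>N * ((1 - t) powr (- k) - 1)\<close>, the bound from \<open>exp_g_along_segment\<close>.
    Its increment over the unit interval is \<open>N * (k / (1 - k))\<close>.\<close>
  have "norm ((f (\<gamma> 1) - A * \<gamma> 1) - (f (\<gamma> 0) - A * \<gamma> 0))
      \<le> N * (- ((1 - 1) powr (1 - k)) / (1 - k) - 1) - N * (- ((1 - 0) powr (1 - k)) / (1 - k) - 0)"
  proof (rule differentiable_bound_general[where f = "\<lambda>t. f (\<gamma> t) - A * \<gamma> t"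
        and \<phi> = "\<lambda>t. N * (- ((1 - t) powr (1 - k)) / (1 - k) - t)"
        and f' = "\<lambda>t. (z - p) * (exp (g (\<gamma> t)) - A)" and \<phi>' = "\<lambda>t. N * ((1 - t) powr (- k) - 1)"])
    have \<gamma>_cont: "continuous_on {0..1} \<gamma>" unfolding \<gamma>_def by (intro continuous_intros)
    moreover have "\<gamma> ` {0..1} \<subseteq> closed_segment p z"
      unfolding \<gamma>_def closed_segment_def by (auto simp: scaleR_conv_of_real algebra_simps)
    ultimately have "continuous_on {0..1} (\<lambda>t. f (\<gamma> t))"
      using continuous_on_compose2[OF cont] by blast
    then show "continuous_on {0..1} (\<lambda>t. f (\<gamma> t) - A * \<gamma> t)"
      using \<gamma>_cont by (intro continuous_intros)
    show "continuous_on {0..1} (\<lambda>t. N * (- ((1 - t) powr (1 - k)) / (1 - k) - t))"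
      using k by (intro continuous_intros continuous_on_powr') auto
    fix t :: real assume t: "0 < t" "t < 1"
    have "norm (\<gamma> t) < 1" unfolding \<gamma>_def using segment_in_disc[OF p z] t by simp
    moreover have \<gamma>': "(\<gamma> has_vector_derivative (z - p)) (at t)"
      unfolding \<gamma>_def by (rule has_vector_derivative_line)
    ultimately have "(f \<circ> \<gamma> has_vector_derivative (z - p) * exp (g (\<gamma> t))) (at t)"
      by (intro field_vector_diff_chain_at deriv_f)
    then have "((\<lambda>t. f (\<gamma> t) - A * \<gamma> t) has_vector_derivative (z - p) * exp (g (\<gamma> t)) - A * (z - p)) (at t)"
      using \<gamma>' by (auto simp: o_def intro!: derivative_intros)
    then show "((\<lambda>t. f (\<gamma> t) - A * \<gamma> t) has_vector_derivative (z - p) * (exp (g (\<gamma> t)) - A)) (at t)"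
      by (simp add: algebra_simps)
    have "((\<lambda>t. N * (- ((1 - t) powr (1 - k)) / (1 - k) - t)) has_field_derivative N * ((1 - t) powr (- k) - 1)) (at t)"
      using t k by (rule_tac derivative_eq_intros refl | simp)+
    then show "((\<lambda>t. N * (- ((1 - t) powr (1 - k)) / (1 - k) - t)) has_vector_derivative N * ((1 - t) powr (- k) - 1)) (at t)"
      by (simp add: has_real_derivative_iff_has_vector_derivative)
    show "norm ((z - p) * (exp (g (\<gamma> t)) - A)) \<le> N * ((1 - t) powr (- k) - 1)"
      using exp_g_along_segment[OF p z, of t] t
      by (simp add: norm_mult N_def A_def k_def \<gamma>_def mult.assoc mult_left_mono)
  qed simp
  also have "\<dots> = N * (k / (1 - k))" using k by (simp add: field_simps)
  also have "k / (1 - k) \<le> 24 * r"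
  proof -
    have "k / (1 - k) \<le> k / (1 / 2)" using k k0 by (intro divide_left_mono) auto
    with k12 show ?thesis by simp
  qed
  finally have "norm ((f (\<gamma> 1) - A * \<gamma> 1) - (f (\<gamma> 0) - A * \<gamma> 0)) \<le> N * (24 * r)"
    using N0 by (simp add: mult_left_mono)
  then show ?thesis by (simp add: \<gamma>_def N_def A_def algebra_simps)
qed

text \<open>Integration along the radius towards the boundary point \<open>sgn p\<close> bounds
  \<open>norm (g p)\<close> by \<open>- r * ln (1 - norm p)\<close>. The factor \<open>r\<close> is
  relaxed to 1/2, which suffices both for the modulus of continuity and for integrability along
  lines.\<close>

lemma exp_g_growth:
  assumes "norm p < 1" shows "norm (exp (g p)) \<le> 1 / sqrt (1 - norm p)"
proof (cases "p = 0")
  case False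
  define x where "x = 1 - norm p"
  have x: "0 < x" "x \<le> 1" using assms by (auto simp: x_def)
  have "of_real (norm p) * sgn p = p" using False by (simp add: sgn_eq)
  then have "norm (g p) \<le> - r * ln x"
    using g_along_segment[of 0 "sgn p" "norm p"] assms False
    by (simp add: g_0 norm_sgn x_def)
  also have "\<dots> = r * (- ln x)" by simp
  also have "\<dots> \<le> (1 / 2) * (- ln x)" using x r by (intro mult_right_mono) auto
  also have "\<dots> = - ln (sqrt x)" using x by (simp add: ln_sqrt)
  finally have "norm (exp (g p)) \<le> exp (- ln (sqrt x))" using norm_exp[of "g p"] by (meson exp_le_cancel_iff order_trans)
  also have "\<dots> = 1 / sqrt x" using x by (simp add: exp_minus inverse_eq_divide)
  finally show ?thesis by (simp add: x_def)
qed (simp add: g_0)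

text \<open>In the ball about \<open>p\<close> of half its depth, the depth stays at least half as
  large, so \<open>g'\<close> is at most \<open>2 * r / d\<close> there. Keeping the factor
  \<open>norm (z - p)\<close> matters: it yields the separation \<open>d\<close> in
  \<open>exterior_difference\<close> and cancels \<open>norm w\<close> in
  \<open>norm_F_minus_id\<close>.\<close>

lemma exp_g_near:
  assumes p: "norm p < 1" and z: "norm (z - p) \<le> (1 - norm p) / 2"
  shows "norm (exp (g z) - exp (g p)) \<le> 4 * r * norm (exp (g p)) * (norm (z - p) / (1 - norm p))"
proof -
  define d where "d = 1 - norm p"
  have d: "0 < d" using p by (simp add: d_def)
  define D where "D = g z - g p"
  have "norm D \<le> 2 * r / d * norm (z - p)"
    unfolding D_def
  proof (rule field_differentiable_bound[of "cball p (d / 2)" _ g'])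
    fix w assume "w \<in> cball p (d / 2)"
    then have w: "norm w \<le> 1 - d / 2"
      using norm_triangle_sub[of w p] by (simp add: dist_norm norm_minus_commute d_def field_simps)
    then have w1: "norm w < 1" using d by simp
    then show "(g has_field_derivative g' w) (at w within cball p (d / 2))"
      using deriv_g has_field_derivative_at_within by blast
    have "r / (1 - norm w) \<le> r / (d / 2)"
      using w d r by (intro divide_left_mono) auto
    with norm_g'_le[OF w1] show "norm (g' w) \<le> 2 * r / d" by (simp add: mult.commute)
  qed (use z d in \<open>auto simp: dist_norm norm_minus_commute d_def\<close>)
  also have "\<dots> = 2 * r * (norm (z - p) / d)" by simp
  finally have D: "norm D \<le> 2 * r * (norm (z - p) / d)" .
  have "norm (z - p) / d \<le> 1 / 2" using z d by (simp add: d_def field_simps)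
  then have "2 * r * (norm (z - p) / d) \<le> 2 * r * (1 / 2)" using r by (intro mult_left_mono) auto
  then have "norm D \<le> 1 / 2" using D r by simp
  then have "exp (norm D) \<le> 1 + 2 * norm D" using exp_bound_lemma[of "norm D"] by simp
  then have "norm (exp D - 1) \<le> 4 * r * (norm (z - p) / d)"
    using norm_exp_minus_1_le[of D] D by simp
  moreover have "exp (g z) - exp (g p) = exp (g p) * (exp D - 1)"
    by (simp add: D_def exp_diff algebra_simps)
  ultimately have "norm (exp (g z) - exp (g p)) \<le> norm (exp (g p)) * (4 * r * (norm (z - p) / d))"
    unfolding \<open>exp (g z) - exp (g p) = exp (g p) * (exp D - 1)\<close> norm_mult by (intro mult_left_mono) auto
  then show ?thesis by (simp add: d_def algebra_simps)
qed

lemma continuous_on_disc: "continuous_on (ball 0 1) f"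
  using deriv_f by (intro continuous_at_imp_continuous_on ballI) (auto intro: DERIV_isCont)

lemma depth_of_shrunk:
  fixes u :: complex
  assumes "norm u \<le> 1" "0 < d" "d \<le> 1"
  shows "norm (of_real (1 - d) * u) \<le> 1 - d" "norm (u - of_real (1 - d) * u) \<le> d"
proof -
  have "norm (of_real (1 - d) * u) = (1 - d) * norm u" using assms by (simp add: norm_mult del: of_real_diff)
  also have "\<dots> \<le> 1 - d" using assms by (simp add: mult_left_le)
  finally show "norm (of_real (1 - d) * u) \<le> 1 - d" .
  have "u - of_real (1 - d) * u = of_real d * u" by (simp add: algebra_simps)
  then show "norm (u - of_real (1 - d) * u) \<le> d" using assms by (simp add: norm_mult mult_left_le)
qed

section \<open>Pairs of points in the disc\<close>

text \<open>The base point is \<open>z1\<close> shrunk until its depth is at least the separation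
  \<open>d\<close>. Both points lie within \<open>2 * d\<close> of it, so the two affine errors add
  up to \<open>24 * r * (1 + 2) = 72 * r\<close> times the main term. An error of at most half the
  main term gives injectivity as well as continuity.\<close>

lemma disc_difference:
  assumes z: "norm z1 < 1" "norm z2 < 1" and d: "d = norm (z1 - z2)" "0 < d" "d \<le> 1"
  obtains p where "norm p \<le> 1 - d"
    "norm (f z1 - f z2 - exp (g p) * (z1 - z2)) \<le> norm (exp (g p)) * d / 2"
proof -
  define p where "p = of_real (1 - d) * z1"
  have p: "norm p \<le> 1 - d" and z1: "norm (z1 - p) \<le> d"
    unfolding p_def using depth_of_shrunk[of z1 d] z d by auto
  have z2: "norm (z2 - p) \<le> 2 * d"
    using z1 norm_triangle_ineq[of "z2 - z1" "z1 - p"] d by (simp add: norm_minus_commute)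
  have p1: "norm p < 1" using p d(2) by linarith
  have seg: "continuous_on (closed_segment p z) f" if "norm z < 1" for z
    using continuous_on_disc by (rule continuous_on_subset)
      (use closed_segment_subset[of p "ball 0 1" z] p1 that in auto)
  have near: "norm (z1 - p) \<le> 12 * (1 - norm p)" "norm (z2 - p) \<le> 12 * (1 - norm p)"
    using z1 z2 p d(2) by argo+
  let ?A = "norm (exp (g p))"
  have "norm (f z1 - f z2 - exp (g p) * (z1 - z2)) \<le> 24 * r * ?A * norm (z1 - p) + 24 * r * ?A * norm (z2 - p)"
    using z by (intro norm_diff_linear_combine[where Y = "f p" and p = p] affine_approximation seg p1 near) auto
  also have "\<dots> \<le> 24 * r * ?A * d + 24 * r * ?A * (2 * d)"
    using z1 z2 r by (intro add_mono mult_left_mono) auto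
  also have "\<dots> = (72 * r) * (?A * d)" by (simp add: algebra_simps)
  also have "\<dots> \<le> (1 / 2) * (?A * d)" using r d by (intro mult_right_mono) auto
  finally show thesis using p by (intro that[of p]) auto
qed

text \<open>At depth at least \<open>d\<close> the scale factor is at most
  \<open>1 / sqrt d\<close>, so the main term is at most \<open>sqrt d\<close> and the error at most
  half of that.\<close>

lemma norm_le_sqrt_modulus:
  assumes p: "norm p \<le> 1 - d" and d: "0 < d" "norm v = d"
    and X: "norm (X - exp (g p) * v) \<le> norm (exp (g p)) * d / 2"
  shows "norm X \<le> 2 * sqrt d"
proof -
  have "norm (exp (g p)) \<le> 1 / sqrt (1 - norm p)" using exp_g_growth p d by simp
  also have "\<dots> \<le> 1 / sqrt d" using p d by (intro frac_le) auto
  finally have "norm (exp (g p)) * d \<le> 1 / sqrt d * d" using d by (intro mult_right_mono) auto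
  then have A: "norm (exp (g p)) * d \<le> sqrt d" using d by (simp add: real_div_sqrt)
  have "norm X \<le> norm (X - exp (g p) * v) + norm (exp (g p)) * d"
    using norm_triangle_sub[of X "exp (g p) * v"] by (simp add: norm_mult d)
  also have "\<dots> \<le> 2 * sqrt d" using X A d real_sqrt_ge_zero[of d] by linarith
  finally show ?thesis .
qed

text \<open>This Hoelder estimate of exponent 1/2 is what allows \<open>f\<close> to be extended
  continuously to the closed disc.\<close>

lemma uniformly_continuous_on_disc: "uniformly_continuous_on (ball 0 1) f"
  unfolding uniformly_continuous_on_def
proof (intro allI impI)
  fix e :: real assume e: "0 < e"
  \<comment> \<open>The 1 meets the hypothesis \<open>d \<le> 1\<close> of
    \<open>disc_difference\<close>; the square makes \<open>2 * sqrt d\<close> less than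
    \<open>e\<close>.\<close>
  define \<delta> where "\<delta> = min 1 ((e / 2)\<^sup>2)"
  have "dist (f z2) (f z1) < e" if z: "norm z1 < 1" "norm z2 < 1" "dist z2 z1 < \<delta>" for z1 z2
  proof (cases "z1 = z2")
    case False
    define d where "d = norm (z1 - z2)"
    have d: "0 < d" "d < 1" "d < (e / 2)\<^sup>2" using False z by (auto simp: d_def dist_norm norm_minus_commute \<delta>_def)
    then obtain p where p: "norm p \<le> 1 - d"
      "norm (f z1 - f z2 - exp (g p) * (z1 - z2)) \<le> norm (exp (g p)) * d / 2"
      using disc_difference[OF z(1,2) d_def] by auto
    have "norm (f z1 - f z2) \<le> 2 * sqrt d" using norm_le_sqrt_modulus[OF p(1) d(1) _ p(2)] by (simp add: d_def)
    also have "sqrt d < e / 2" using d e by (intro real_less_lsqrt) auto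
    finally show ?thesis by (simp add: dist_norm norm_minus_commute)
  qed (use e in simp)
  moreover have "\<delta> > 0" using e by (simp add: \<delta>_def)
  ultimately show "\<exists>\<delta>>0. \<forall>x\<in>ball 0 1. \<forall>x'\<in>ball 0 1. dist x' x < \<delta> \<longrightarrow> dist (f x') (f x) < e"
    by (intro exI[of _ \<delta>]) auto
qed

end

subsection \<open>Becker's extension\<close>

text \<open>Reflection in the unit circle. Its value at 0 is 0 by the convention on division, which
  keeps \<open>norm_reflect\<close> valid there.\<close>

definition reflect :: "complex \<Rightarrow> complex" where "reflect w = 1 / cnj w"

lemma norm_reflect: "norm (reflect w) = 1 / norm w"
  by (simp add: reflect_def norm_divide)

lemma norm_reflect_le_1: "1 \<le> norm w \<Longrightarrow> norm (reflect w) \<le> 1"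
  by (simp add: norm_reflect divide_le_eq_1)

lemma minus_reflect:
  assumes "w \<noteq> 0" shows "w - reflect w = of_real ((norm w)\<^sup>2 - 1) / cnj w"
proof -
  have "w * cnj w = of_real ((norm w)\<^sup>2)" by (rule complex_norm_square[symmetric])
  then show ?thesis using assms by (simp add: reflect_def field_simps)
qed

text \<open>The second form exhibits the depth of the reflected point, the factor that compensates
  for the possible blow-up of \<open>exp (g (reflect w))\<close> near the circle.\<close>

lemma norm_minus_reflect:
  assumes "1 \<le> norm w"
  shows "norm (w - reflect w) = ((norm w)\<^sup>2 - 1) / norm w"
    and "norm (w - reflect w) = (norm w + 1) * (1 - norm (reflect w))"
proof -
  have w: "w \<noteq> 0" using assms by auto
  have "1 \<le> (norm w)\<^sup>2" using assms by simp
  then show *: "norm (w - reflect w) = ((norm w)\<^sup>2 - 1) / norm w"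
    unfolding minus_reflect[OF w] norm_divide by (simp del: of_real_diff)
  show "norm (w - reflect w) = (norm w + 1) * (1 - norm (reflect w))"
    unfolding * norm_reflect using w by (simp add: field_simps power2_eq_square)
qed

lemma norm_reflect_diff:
  assumes "w1 \<noteq> 0" "w2 \<noteq> 0"
  shows "norm (reflect w1 - reflect w2) = norm (w1 - w2) / (norm w1 * norm w2)"
proof -
  have "reflect w1 - reflect w2 = cnj (w2 - w1) / (cnj w1 * cnj w2)"
    using assms by (simp add: reflect_def field_simps)
  then show ?thesis by (simp add: norm_divide norm_mult norm_minus_commute del: complex_cnj_diff)
qed

lemma reflect_on_circle:
  assumes "norm w = 1" shows "reflect w = w"
proof -
  have "norm (w - reflect w) = 0" using norm_minus_reflect(1)[of w] assms by simp
  then show ?thesis by simp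
qed

text \<open>Boundary values now matter, since the extension takes the values of \<open>f\<close> on
  the circle. In \<open>restrict_in_D_tilde\<close> the role of \<open>f\<close> is played by a
  continuous extension from the open disc.\<close>

locale bloch_extension = bloch_primitive +
  assumes cont_f: "continuous_on (cball 0 1) f" and f_0: "f 0 = 0"
begin

definition F :: "complex \<Rightarrow> complex" where
  "F w = (if norm w \<le> 1 then f w else f (reflect w) + (w - reflect w) * exp (g (reflect w)))"

lemma F_inside: "norm w \<le> 1 \<Longrightarrow> F w = f w"
  by (simp add: F_def)

lemma F_outside: "1 \<le> norm w \<Longrightarrow> F w = f (reflect w) + (w - reflect w) * exp (g (reflect w))"
  by (cases "norm w = 1") (auto simp: F_def reflect_on_circle)

lemma affine_approximation_closed:
  assumes "norm p < 1" "norm z \<le> 1" "norm (z - p) \<le> 12 * (1 - norm p)"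
  shows "norm (f z - f p - exp (g p) * (z - p)) \<le> 24 * r * norm (exp (g p)) * norm (z - p)"
proof (rule affine_approximation[OF assms])
  have "closed_segment p z \<subseteq> cball 0 1" using assms by (intro closed_segment_subset) auto
  then show "continuous_on (closed_segment p z) f" using cont_f continuous_on_subset by blast
qed

section \<open>Affine approximation of the extension\<close>

text \<open>Cauchy's estimate for the affine error on the largest disc about \<open>z\<close> inside
  the unit disc. It controls the derivative only after multiplication by the depth of
  \<open>z\<close>.\<close>

lemma derivative_variation:
  assumes p: "norm p < 1" and z: "norm z < 1" and near: "norm (z - p) + (1 - norm z) \<le> 12 * (1 - norm p)"
  shows "(1 - norm z) * norm (exp (g z) - exp (g p)) \<le> 24 * r * norm (exp (g p)) * (norm (z - p) + (1 - norm z))"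
proof -
  define \<rho> where "\<rho> = 1 - norm z"
  define h where "h \<xi> = f \<xi> - f p - exp (g p) * (\<xi> - p)" for \<xi>
  define B where "B = 24 * r * norm (exp (g p)) * (norm (z - p) + (1 - norm z))"
  have \<rho>: "0 < \<rho>" using z by (simp add: \<rho>_def)
  have sub: "cball z \<rho> \<subseteq> cball 0 1" "ball z \<rho> \<subseteq> ball 0 1"
    using cball_subset_cball_iff[of z \<rho> "0::complex" 1] ball_subset_ball_iff[of z \<rho> "0::complex" 1]
    by (auto simp: \<rho>_def dist_norm)
  have h': "(h has_field_derivative exp (g \<xi>) - exp (g p)) (at \<xi>)" if "norm \<xi> < 1" for \<xi>
    unfolding h_def by (rule deriv_f[OF that] derivative_eq_intros refl | simp)+
  have "norm ((deriv ^^ 1) h z) \<le> fact 1 * B / \<rho> ^ 1"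
  proof (rule Cauchy_inequality)
    show "h holomorphic_on ball z \<rho>"
      unfolding holomorphic_on_open[OF open_ball] using h' sub(2) by (metis mem_ball_0 subsetD)
    show "continuous_on (cball z \<rho>) h"
      unfolding h_def by (intro continuous_intros continuous_on_subset[OF cont_f sub(1)])
    fix x assume x: "norm (z - x) = \<rho>"
    have dist: "norm (x - p) \<le> norm (z - p) + (1 - norm z)"
      using norm_triangle_ineq[of "x - z" "z - p"] x by (simp add: \<rho>_def norm_minus_commute)
    have "x \<in> cball z \<rho>" using x by (simp add: dist_norm)
    then have "norm x \<le> 1" using sub(1) by auto
    then have "norm (h x) \<le> 24 * r * norm (exp (g p)) * norm (x - p)"
      unfolding h_def using dist near by (intro affine_approximation_closed p) auto
    also have "\<dots> \<le> B" unfolding B_def using dist r by (intro mult_left_mono) auto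
    finally show "norm (h x) \<le> B" .
  qed (rule \<rho>)
  moreover have "deriv h z = exp (g z) - exp (g p)" using h'[OF z] by (rule DERIV_imp_deriv)
  ultimately have "norm (exp (g z) - exp (g p)) \<le> B / \<rho>" by simp
  then show ?thesis using \<rho> unfolding B_def \<rho>_def by (simp add: pos_le_divide_eq mult.commute)
qed

text \<open>The deviation of \<open>F w\<close> from the affine map is that of
  \<open>f \<zeta>\<close> plus \<open>(w - \<zeta>) * (exp (g \<zeta>) - exp (g p))\<close>. The
  factor \<open>w - \<zeta>\<close> supplies the depth required by
  \<open>derivative_variation\<close>; on the circle it is 0 and the second term vanishes.\<close>

lemma affine_approximation_outside:
  fixes w :: complex
  defines "\<zeta> \<equiv> reflect w"
  assumes p: "norm p < 1" and w: "1 \<le> norm w" and near: "norm (\<zeta> - p) + (1 - norm \<zeta>) \<le> 12 * (1 - norm p)"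
  shows "norm (F w - f p - exp (g p) * (w - p))
    \<le> 24 * r * norm (exp (g p)) * (norm (\<zeta> - p) + (norm w + 1) * (norm (\<zeta> - p) + (1 - norm \<zeta>)))"
proof -
  let ?A = "norm (exp (g p))"
  have \<zeta>: "norm \<zeta> \<le> 1" using w by (simp add: \<zeta>_def norm_reflect_le_1)
  have "F w - f p - exp (g p) * (w - p)
      = (f \<zeta> - f p - exp (g p) * (\<zeta> - p)) + (w - \<zeta>) * (exp (g \<zeta>) - exp (g p))"
    using F_outside[OF w] by (simp add: \<zeta>_def algebra_simps)
  also have "norm \<dots> \<le> norm (f \<zeta> - f p - exp (g p) * (\<zeta> - p)) + norm (w - \<zeta>) * norm (exp (g \<zeta>) - exp (g p))"
    using norm_triangle_ineq norm_mult by metis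
  also have "\<dots> \<le> 24 * r * ?A * norm (\<zeta> - p) + (norm w + 1) * (24 * r * ?A * (norm (\<zeta> - p) + (1 - norm \<zeta>)))"
  proof (rule add_mono)
    show "norm (f \<zeta> - f p - exp (g p) * (\<zeta> - p)) \<le> 24 * r * ?A * norm (\<zeta> - p)"
      using near \<zeta> by (intro affine_approximation_closed p) auto
    show "norm (w - \<zeta>) * norm (exp (g \<zeta>) - exp (g p))
        \<le> (norm w + 1) * (24 * r * ?A * (norm (\<zeta> - p) + (1 - norm \<zeta>)))"
    proof (cases "norm \<zeta> < 1")
      case True
      show ?thesis
        unfolding \<zeta>_def norm_minus_reflect(2)[OF w] mult.assoc[of "norm w + 1"]
        using derivative_variation[OF p, of \<zeta>] True near
        by (intro mult_left_mono) (auto simp: \<zeta>_def)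
    next
      case False
      then have "norm w = 1" using \<zeta> w by (auto simp: \<zeta>_def norm_reflect)
      then have "w = \<zeta>" by (simp add: \<zeta>_def reflect_on_circle)
      then show ?thesis using r \<zeta> by simp
    qed
  qed
  also have "\<dots> = 24 * r * ?A * (norm (\<zeta> - p) + (norm w + 1) * (norm (\<zeta> - p) + (1 - norm \<zeta>)))"
    by (simp add: algebra_simps)
  finally show ?thesis .
qed

section \<open>Pairs of points near and outside the circle\<close>

text \<open>The base point is the reflection of \<open>w1\<close>, shrunk to depth at least
  \<open>d\<close>. Everything in sight is then within a fixed multiple of \<open>d\<close> from it,
  whichever side of the circle \<open>w2\<close> lies on.\<close>

lemma near_circle_difference:
  assumes d: "d = norm (w1 - w2)" "0 < d" "d \<le> 1"
    and w: "1 \<le> norm w1" "norm w1 \<le> 1 + 2 * d" "norm w2 \<le> 1 + 2 * d"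
  obtains p where "norm p \<le> 1 - d"
    "norm (F w1 - F w2 - exp (g p) * (w1 - w2)) \<le> norm (exp (g p)) * d / 2"
proof -
  define \<zeta> where "\<zeta> = reflect w1"
  define p where "p = of_real (1 - d) * \<zeta>"
  have \<zeta>: "norm \<zeta> \<le> 1" using w by (simp add: \<zeta>_def norm_reflect_le_1)
  have p: "norm p \<le> 1 - d" and \<zeta>p: "norm (\<zeta> - p) \<le> d"
    unfolding p_def using depth_of_shrunk[OF \<zeta>] d by auto
  have p1: "norm p < 1" using p d(2) by linarith
  let ?A = "norm (exp (g p))"
  have depth: "1 - norm (reflect w) \<le> 2 * d" and jump: "norm (w - reflect w) \<le> 4 * d"
    if w: "1 \<le> norm w" "norm w \<le> 1 + 2 * d" for w
  proof -
    have inv: "1 / norm w \<le> 1" using w by (simp add: divide_le_eq_1)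
    have "1 - 1 / norm w = (norm w - 1) * (1 / norm w)"
      using w by (cases "w = 0") (auto simp: diff_divide_distrib)
    also have "\<dots> \<le> (norm w - 1) * 1" using w inv by (intro mult_left_mono) auto
    finally show "1 - norm (reflect w) \<le> 2 * d" using w by (simp add: norm_reflect)
    have "norm (w - reflect w) = (norm w - 1) * (1 + 1 / norm w)"
      using w by (cases "w = 0") (auto simp: norm_minus_reflect(1) field_simps power2_eq_square)
    also have "\<dots> \<le> (2 * d) * 2" using w inv d by (intro mult_mono) auto
    finally show "norm (w - reflect w) \<le> 4 * d" by simp
  qed
  \<comment> \<open>The 4 bounds \<open>norm w + 1\<close>. With \<open>N = 10\<close> the distance
    plus the depth reaches \<open>12 * d\<close>, which is the origin of the 12 in
    \<open>affine_approximation\<close>.\<close>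
  have outside: "norm (F w - f p - exp (g p) * (w - p)) \<le> 24 * r * ?A * (N * d + 4 * (N * d + 2 * d))"
    if w: "1 \<le> norm w" "norm w \<le> 1 + 2 * d" and N: "norm (reflect w - p) \<le> N * d" "N \<le> 10" for w N
  proof -
    have near: "norm (reflect w - p) + (1 - norm (reflect w)) \<le> N * d + 2 * d"
      using depth[OF w] N by simp
    also have "N * d + 2 * d \<le> 10 * d + 2 * d" using N d by simp
    also have "\<dots> \<le> 12 * (1 - norm p)" using p by simp
    finally have "norm (F w - f p - exp (g p) * (w - p))
      \<le> 24 * r * ?A * (norm (reflect w - p) + (norm w + 1) * (norm (reflect w - p) + (1 - norm (reflect w))))"
      by (intro affine_approximation_outside p1 w)
    also have "\<dots> \<le> 24 * r * ?A * (N * d + 4 * (N * d + 2 * d))"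
      using w N depth[OF w] d r norm_reflect_le_1[OF w(1)]
      by (intro mult_left_mono[of _ _ "24 * r * ?A"] add_mono mult_mono[of "norm w + 1"]) auto
    finally show ?thesis .
  qed
  have w1: "norm (F w1 - f p - exp (g p) * (w1 - p)) \<le> 24 * r * ?A * (1 * d + 4 * (1 * d + 2 * d))"
    by (rule outside) (use w \<zeta>p in \<open>auto simp: \<zeta>_def\<close>)
  \<comment> \<open>The path through \<open>w1\<close> and \<open>\<zeta>\<close> has pieces of
    length at most \<open>d\<close>, \<open>4 * d\<close> and \<open>d\<close>. One more jump of at
    most \<open>4 * d\<close> gives the 10 for the reflection of \<open>w2\<close>.\<close>
  have w2p: "norm (w2 - p) \<le> 6 * d"
    using norm_triangle_ineq[of "w2 - w1" "w1 - p"] norm_triangle_ineq[of "w1 - \<zeta>" "\<zeta> - p"] jump[OF w(1,2)] \<zeta>p d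
    by (simp add: \<zeta>_def norm_minus_commute)
  have w2: "norm (F w2 - f p - exp (g p) * (w2 - p)) \<le> 24 * r * ?A * (58 * d)"
  proof (cases "norm w2 \<le> 1")
    case True
    have "norm (F w2 - f p - exp (g p) * (w2 - p)) \<le> 24 * r * ?A * norm (w2 - p)"
      unfolding F_inside[OF True] by (rule affine_approximation_closed[OF p1 True]) (use w2p p d(2) in argo)
    also have "\<dots> \<le> 24 * r * ?A * (58 * d)" using w2p r d(2) by (intro mult_left_mono) auto
    finally show ?thesis .
  next
    case False
    have "norm (reflect w2 - p) \<le> 10 * d"
      using norm_triangle_ineq[of "reflect w2 - w2" "w2 - p"] jump[of w2] w2p w False
      by (simp add: norm_minus_commute)
    then have "norm (F w2 - f p - exp (g p) * (w2 - p)) \<le> 24 * r * ?A * (10 * d + 4 * (10 * d + 2 * d))"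
      using False w by (intro outside) auto
    then show ?thesis by simp
  qed
  have "norm (F w1 - F w2 - exp (g p) * (w1 - w2)) \<le> 24 * r * ?A * (1 * d + 4 * (1 * d + 2 * d)) + 24 * r * ?A * (58 * d)"
    by (rule norm_diff_linear_combine[OF w1 w2])
  \<comment> \<open>The two errors carry the factors \<open>1 + 4 * 3 = 13\<close> and
    \<open>10 + 4 * 12 = 58\<close>, and \<open>24 * 71 = 1704\<close>.\<close>
  also have "\<dots> = (1704 * r) * (?A * d)" by (simp add: algebra_simps)
  also have "\<dots> \<le> (1 / 2) * (?A * d)" using r d by (intro mult_right_mono) auto
  finally show thesis using p by (intro that[of p]) auto
qed

text \<open>When the pair is close compared with its distance to the circle, the reflections are
  within half the depth of \<open>reflect w1\<close>. This point itself serves as base point, and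
  \<open>exp_g_near\<close> controls the change of \<open>exp \<circ> g\<close>.\<close>

lemma exterior_difference:
  assumes d: "d = norm (w1 - w2)" "d \<le> (norm w1 - 1) / 2" and w1: "1 < norm w1"
  shows "norm (F w1 - F w2 - exp (g (reflect w1)) * (w1 - w2)) \<le> norm (exp (g (reflect w1))) * d / 2"
proof -
  define \<zeta>1 \<zeta>2 where "\<zeta>1 = reflect w1" and "\<zeta>2 = reflect w2"
  define m1 m2 where "m1 = norm w1" and "m2 = norm w2"
  let ?A = "norm (exp (g \<zeta>1))"
  have m1: "1 < m1" using w1 by (simp add: m1_def)
  have m12: "\<bar>m1 - m2\<bar> \<le> d" using norm_triangle_ineq3[of w1 w2] d by (simp add: m1_def m2_def)
  then have m2: "1 < m2" "m2 - 1 \<le> 3 / 2 * (m1 - 1)" using m1 d unfolding m1_def[symmetric] by argo+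
  have d0: "0 \<le> d" using d by simp
  have w0: "w1 \<noteq> 0" "w2 \<noteq> 0" using m1 m2 by (auto simp: m1_def m2_def)
  have norms: "norm \<zeta>1 = 1 / m1" "norm \<zeta>2 = 1 / m2" "norm (\<zeta>2 - \<zeta>1) = d / (m1 * m2)"
    using norm_reflect_diff[of w2 w1] w0
    by (simp_all add: \<zeta>1_def \<zeta>2_def m1_def m2_def norm_reflect d mult.commute norm_minus_commute)
  have \<zeta>: "norm \<zeta>1 < 1" "norm \<zeta>2 \<le> 1" using m1 m2 by (auto simp: norms)
  have ratio: "norm (\<zeta>2 - \<zeta>1) / (1 - norm \<zeta>1) = d / (m1 - 1) * (1 / m2)"
    using m1 m2 by (simp add: norms field_simps)
  have "d / (m1 - 1) \<le> 1 / 2" using d m1 by (simp add: pos_divide_le_eq m1_def)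
  then have "d / (m1 - 1) * (1 / m2) \<le> 1 / 2 * 1" using m1 m2 d0 by (intro mult_mono) auto
  then have near: "norm (\<zeta>2 - \<zeta>1) \<le> (1 - norm \<zeta>1) / 2"
    using \<zeta> unfolding ratio[symmetric] by (simp add: pos_divide_le_eq)
  have "1 * 1 \<le> m1 * m2" using m1 m2 by (intro mult_mono) auto
  then have dist: "norm (\<zeta>2 - \<zeta>1) \<le> d" unfolding norms using d0 by (simp add: divide_le_eq mult_le_cancel_left1)
  have first: "norm (f \<zeta>2 - f \<zeta>1 - exp (g \<zeta>1) * (\<zeta>2 - \<zeta>1)) \<le> 24 * r * ?A * d"
  proof -
    have "norm (f \<zeta>2 - f \<zeta>1 - exp (g \<zeta>1) * (\<zeta>2 - \<zeta>1)) \<le> 24 * r * ?A * norm (\<zeta>2 - \<zeta>1)"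
      using near \<zeta> by (intro affine_approximation_closed) auto
    also have "\<dots> \<le> 24 * r * ?A * d" using dist r by (intro mult_left_mono) auto
    finally show ?thesis .
  qed
  have second: "norm ((w2 - \<zeta>2) * (exp (g \<zeta>2) - exp (g \<zeta>1))) \<le> 12 * r * ?A * d"
  proof -
    have "norm (w2 - \<zeta>2) * norm (exp (g \<zeta>2) - exp (g \<zeta>1))
        \<le> (m2\<^sup>2 - 1) / m2 * (4 * r * ?A * (d / (m1 - 1) * (1 / m2)))"
      using exp_g_near[OF \<zeta>(1) near] norm_minus_reflect(1)[of w2] m2
      unfolding ratio by (intro mult_mono) (auto simp: \<zeta>2_def m2_def)
    \<comment> \<open>The jump is proportional to \<open>m2 - 1\<close> and the change of
      \<open>exp \<circ> g\<close> to \<open>1 / (m1 - 1)\<close>. Their quotient is at most 3/2,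
      and the remaining factors are at most 2 and 1.\<close>
    also have "\<dots> = 4 * r * ?A * d * ((m2 - 1) / (m1 - 1) * ((m2 + 1) / m2 * (1 / m2)))"
      using m1 m2 by (simp add: field_simps power2_eq_square)
    also have "\<dots> \<le> 4 * r * ?A * d * (3 / 2 * (2 * 1))"
      using r d0 m1 m2
      by (intro mult_left_mono[of _ _ "4 * r * ?A * d"] mult_mono) (auto simp: pos_divide_le_eq)
    finally show ?thesis by (simp add: norm_mult)
  qed
  have F12: "F w1 = f \<zeta>1 + (w1 - \<zeta>1) * exp (g \<zeta>1)" "F w2 = f \<zeta>2 + (w2 - \<zeta>2) * exp (g \<zeta>2)"
    using F_outside[of w1] F_outside[of w2] m1 m2 by (auto simp: \<zeta>1_def \<zeta>2_def m1_def m2_def)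
  have "F w2 - F w1 - exp (g \<zeta>1) * (w2 - w1)
      = (f \<zeta>2 - f \<zeta>1 - exp (g \<zeta>1) * (\<zeta>2 - \<zeta>1)) + (w2 - \<zeta>2) * (exp (g \<zeta>2) - exp (g \<zeta>1))"
    unfolding F12 by (simp add: algebra_simps)
  then have "norm (F w2 - F w1 - exp (g \<zeta>1) * (w2 - w1)) \<le> 24 * r * ?A * d + 12 * r * ?A * d"
    using norm_triangle_mono[OF first second] by simp
  moreover have "F w1 - F w2 - exp (g \<zeta>1) * (w1 - w2) = - (F w2 - F w1 - exp (g \<zeta>1) * (w2 - w1))"
    by (simp add: algebra_simps)
  ultimately have "norm (F w1 - F w2 - exp (g \<zeta>1) * (w1 - w2)) \<le> (36 * r) * (?A * d)"
    by (simp only: norm_minus_cancel)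
  also have "\<dots> \<le> (1 / 2) * (?A * d)" using r d0 by (intro mult_right_mono) auto
  finally show ?thesis by (simp add: \<zeta>1_def)
qed

section \<open>The extension as a homeomorphism of the plane\<close>

text \<open>With base point 0 the approximating affine map is the identity. For large
  \<open>w\<close> the factor \<open>w - \<zeta>\<close> is unbounded, but
  \<open>exp (g \<zeta>) - 1\<close> is of order \<open>norm \<zeta> = 1 / norm w\<close> and
  compensates.\<close>

lemma norm_F_minus_id: "norm (F w - w) \<le> 1 / 4"
proof -
  have A: "norm (exp (g 0)) = 1" by (simp add: g_0)
  consider "norm w \<le> 1" | "1 \<le> norm w" "norm w \<le> 2" | "2 \<le> norm w" by linarith
  then show ?thesis
  proof cases
    case 1
    then have "norm (F w - w) \<le> 24 * r * norm w"
      using affine_approximation_closed[of 0 w] by (simp add: F_inside f_0 g_0)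
    also have "\<dots> \<le> 24 * r * 1" using 1 r by (intro mult_left_mono) auto
    finally show ?thesis using r by simp
  next
    case 2
    then have "norm (F w - w) \<le> 24 * r * (norm (reflect w) + (norm w + 1) * 1)"
      using affine_approximation_outside[of 0 w] by (simp add: f_0 g_0)
    also have "\<dots> \<le> 24 * r * (1 + 3 * 1)"
      using 2 r norm_reflect_le_1[OF 2(1)] by (intro mult_left_mono add_mono mult_right_mono) auto
    finally show ?thesis using r by simp
  next
    case 3
    define \<zeta> where "\<zeta> = reflect w"
    have n: "norm \<zeta> = 1 / norm w" "1 / norm w \<le> 1 / 2"
      using 3 frac_le[of 1 1 2 "norm w"] by (auto simp: \<zeta>_def norm_reflect)
    then have \<zeta>: "norm \<zeta> \<le> 1 / 2" by simp
    have "norm (w - \<zeta>) \<le> norm w"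
      using 3 by (simp add: \<zeta>_def norm_minus_reflect(1) divide_le_eq power2_eq_square)
    moreover have "norm (exp (g \<zeta>) - 1) \<le> 4 * r * norm \<zeta>"
      using exp_g_near[of 0 \<zeta>] \<zeta> by (simp add: g_0)
    ultimately have "norm (w - \<zeta>) * norm (exp (g \<zeta>) - 1) \<le> norm w * (4 * r * (1 / norm w))"
      unfolding n by (intro mult_mono) auto
    then have "norm ((w - \<zeta>) * (exp (g \<zeta>) - 1)) \<le> 4 * r"
      using 3 by (cases "w = 0") (auto simp: norm_mult)
    moreover have "norm (f \<zeta> - \<zeta>) \<le> 24 * r * 1"
    proof -
      have "norm (f \<zeta> - \<zeta>) \<le> 24 * r * norm \<zeta>"
        using affine_approximation_closed[of 0 \<zeta>] \<zeta> by (simp add: f_0 g_0)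
      also have "\<dots> \<le> 24 * r * 1" using \<zeta> r by (intro mult_left_mono) auto
      finally show ?thesis .
    qed
    moreover have "F w - w = (f \<zeta> - \<zeta>) + (w - \<zeta>) * (exp (g \<zeta>) - 1)"
      using F_outside[of w] 3 by (simp add: \<zeta>_def algebra_simps)
    ultimately have "norm (F w - w) \<le> 24 * r * 1 + 4 * r" using norm_triangle_mono by metis
    then show ?thesis using r by simp
  qed
qed

text \<open>If two values agreed, the linear term \<open>exp (g p) * (w1 - w2)\<close> would be at
  most half of itself in norm. The three difference estimates cover all positions of the point
  \<open>w1\<close> of larger norm.\<close>

lemma inj_F: "inj F"
proof -
  have "F w1 \<noteq> F w2" if ne: "w1 \<noteq> w2" and le: "norm w2 \<le> norm w1" for w1 w2
  proof
    assume eq: "F w1 = F w2"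
    define d where "d = norm (w1 - w2)"
    have d: "0 < d" using ne by (simp add: d_def)
    \<comment> \<open>Points with equal images differ by the difference of their displacements, each
      of norm at most 1/4.\<close>
    have small: "d \<le> 1"
    proof -
      have "w1 - w2 = (F w2 - w2) - (F w1 - w1)" using eq by simp
      then have "d \<le> norm (F w2 - w2) + norm (F w1 - w1)" unfolding d_def using norm_triangle_ineq4 by metis
      then show ?thesis using norm_F_minus_id[of w1] norm_F_minus_id[of w2] by linarith
    qed
    have "\<exists>p. norm (F w1 - F w2 - exp (g p) * (w1 - w2)) \<le> norm (exp (g p)) * d / 2"
    proof -
      consider "norm w1 < 1" | "1 \<le> norm w1" "norm w1 \<le> 1 + 2 * d" | "1 + 2 * d \<le> norm w1" by linarith
      then show ?thesis
      proof cases
        case 1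
        then show ?thesis using disc_difference[OF 1 _ d_def d small] le by (metis F_inside less_imp_le order_le_less_trans)
      next
        case 2
        then show ?thesis using near_circle_difference[OF d_def d small 2] le by (metis order_trans)
      next
        case 3
        then show ?thesis using exterior_difference[OF d_def] d by (intro exI[of _ "reflect w1"]) auto
      qed
    qed
    then obtain p where "norm (exp (g p) * (w1 - w2)) \<le> norm (exp (g p)) * d / 2"
      unfolding eq by (metis diff_self minus_diff_eq diff_0 norm_minus_cancel)
    then have "norm (exp (g p)) * d \<le> norm (exp (g p)) * d / 2" by (simp add: norm_mult d_def)
    moreover have "0 < norm (exp (g p)) * d" using d by simp
    ultimately show False by linarith
  qed
  then show ?thesis by (intro injI) (metis linorder_linear)
qed

lemma continuous_F: "continuous_on UNIV F"
proof (rule continuous_at_imp_continuous_on, rule ballI)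
  fix w :: complex
  consider "norm w < 1" | "norm w = 1" | "1 < norm w" by linarith
  then show "isCont F w"
  proof cases
    case 1
    then have "isCont f w" using deriv_f by (auto intro: DERIV_isCont)
    moreover have "eventually (\<lambda>z. f z = F z) (nhds w)"
      using eventually_nhds_in_open[of "ball 0 1" w] 1
      by (auto elim!: eventually_mono simp: F_inside)
    ultimately show ?thesis by (simp add: isCont_cong)
  next
    case 2
    \<comment> \<open>The point \<open>w\<close> on the circle takes the role of \<open>w1\<close>,
      and \<open>z\<close> may lie on either side.\<close>
    have "norm (F z - F w) \<le> 2 * sqrt (norm (z - w))" if "norm (z - w) < 1" for z
    proof (cases "z = w")
      case False
      define d where "d = norm (w - z)"
      have d: "0 < d" "d \<le> 1" using False that by (auto simp: d_def norm_minus_commute)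
      have "norm z \<le> 1 + 2 * d"
        using norm_triangle_ineq2[of z w] 2 d(1) unfolding d_def norm_minus_commute[of w z] by linarith
      then obtain p where p: "norm p \<le> 1 - d"
        "norm (F w - F z - exp (g p) * (w - z)) \<le> norm (exp (g p)) * d / 2"
        using near_circle_difference[OF d_def d, of] 2 d by auto
      have "norm (F w - F z) \<le> 2 * sqrt d"
        using norm_le_sqrt_modulus[OF p(1) d(1) _ p(2)] by (simp add: d_def)
      then show ?thesis by (simp add: d_def norm_minus_commute)
    qed simp
    then have "eventually (\<lambda>z. norm (F z - F w) \<le> 2 * sqrt (norm (z - w))) (at w)"
      unfolding eventually_at by (intro exI[of _ 1]) (auto simp: dist_norm)
    moreover have "((\<lambda>z. 2 * sqrt (norm (z - w))) \<longlongrightarrow> 0) (at w)"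
      by (auto intro!: tendsto_eq_intros)
    ultimately have "((\<lambda>z. F z - F w) \<longlongrightarrow> 0) (at w)" by (rule Lim_null_comparison)
    then show ?thesis by (simp add: isCont_def LIM_zero_iff)
  next
    case 3
    have "norm (reflect w) < 1" using 3 by (simp add: norm_reflect divide_less_eq_1)
    then have "isCont f (reflect w)" "isCont g (reflect w)"
      using deriv_f deriv_g by (auto intro: DERIV_isCont)
    moreover have "isCont reflect w"
      unfolding reflect_def using 3 by (intro continuous_intros) auto
    ultimately have "isCont (\<lambda>w. f (reflect w) + (w - reflect w) * exp (g (reflect w))) w"
      by (intro continuous_intros isCont_o2[of _ reflect f] isCont_o2[of _ reflect g]) auto
    moreover have "eventually (\<lambda>z. f (reflect z) + (z - reflect z) * exp (g (reflect z)) = F z) (nhds w)"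
      using eventually_nhds_in_open[OF open_Compl[OF closed_cball[of 0 1]], of w] 3
      by (auto elim!: eventually_mono simp: F_outside)
    ultimately show ?thesis by (simp add: isCont_cong)
  qed
qed

text \<open>The displacement \<^term>\<open>\<lambda>w. w - F w\<close> is bounded, so \<^term>\<open>\<lambda>w. y + w - F w\<close> has a fixed point.\<close>

lemma surj_F: "surj F"
proof -
  have "\<exists>w. F w = y" for y
  proof -
    have "\<exists>w\<in>cball y 1. y + w - F w = w"
    proof (rule brouwer[of "cball y 1" "\<lambda>w. y + w - F w"])
      show "continuous_on (cball y 1) (\<lambda>w. y + w - F w)"
        by (intro continuous_intros continuous_on_subset[OF continuous_F]) auto
      show "(\<lambda>w. y + w - F w) \<in> cball y 1 \<rightarrow> cball y 1"
      proof
        fix w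
        have "dist y (y + w - F w) = norm (F w - w)" by (simp add: dist_norm algebra_simps)
        then show "y + w - F w \<in> cball y 1" using norm_F_minus_id[of w] by simp
      qed
    qed auto
    then show ?thesis by (auto simp: algebra_simps)
  qed
  then show ?thesis by (metis surj_def)
qed

lemma homeomorphism_F: "\<exists>G. homeomorphism UNIV UNIV F G"
proof -
  obtain G where "homeomorphism UNIV (range F) F G"
    using invariance_of_domain_homeomorphism[OF open_UNIV continuous_F _ inj_F] by blast
  then show ?thesis using surj_F by auto
qed

section \<open>Dilatation and absolute continuity on lines\<close>

text \<open>Outside the disc the derivative of \<open>f \<circ> reflect\<close> cancels against that
  of \<open>- reflect\<close> times \<open>exp (g \<zeta>)\<close>. What is left of the antilinear
  part comes from differentiating \<open>exp \<circ> g \<circ> reflect\<close>, and its ratio to the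
  linear part is \<open>norm (g' \<zeta>) * (1 - (norm \<zeta>)\<^sup>2) / norm w\<close>, hence at
  most \<open>r\<close>. Inside, \<open>F\<close> is holomorphic and \<open>b = 0\<close>.\<close>

lemma F_has_derivative:
  assumes "norm w \<noteq> 1"
  obtains a b where "(F has_derivative (\<lambda>v. a * v + b * cnj v)) (at w)" "norm b \<le> r * norm a"
    "norm a \<le> 2 * max 1 (norm w) / sqrt \<bar>(norm w)\<^sup>2 - 1\<bar>"
proof -
  \<comment> \<open>Used with \<open>R = max 1 (norm w)\<close> and
    \<open>Q = \<bar>(norm w)\<^sup>2 - 1\<bar>\<close>. This form of the bound is chosen because
    \<open>(norm w)\<^sup>2 - 1\<close> is a quadratic polynomial along each line parallel to an
    axis.\<close>
  have growth: "norm (exp (g \<zeta>)) \<le> 2 * R / sqrt Q"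
    if "norm \<zeta> < 1" "0 < Q" "Q \<le> 2 * R\<^sup>2 * (1 - norm \<zeta>)" "1 \<le> R" for \<zeta> Q R
  proof -
    have "sqrt Q \<le> sqrt ((2 * R)\<^sup>2 * (1 - norm \<zeta>))"
      using that by (intro real_sqrt_le_mono) (simp add: power_mult_distrib)
    also have "\<dots> = 2 * R * sqrt (1 - norm \<zeta>)"
      unfolding real_sqrt_mult real_sqrt_abs using that by simp
    finally have "1 / sqrt (1 - norm \<zeta>) \<le> 2 * R / sqrt Q"
      using that by (simp add: field_simps)
    with exp_g_growth[OF that(1)] show ?thesis by linarith
  qed
  show thesis
  proof (cases "norm w < 1")
    case True
    have "(f has_derivative (\<lambda>v. exp (g w) * v + 0 * cnj v)) (at w)"
      using deriv_f[OF True] by (simp add: has_field_derivative_def)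
    then have "(F has_derivative (\<lambda>v. exp (g w) * v + 0 * cnj v)) (at w)"
      by (rule has_derivative_transform_within_open[of _ _ _ _ "ball 0 1"]) (use True in \<open>auto simp: F_inside\<close>)
    moreover have "norm (exp (g w)) \<le> 2 * max 1 (norm w) / sqrt \<bar>(norm w)\<^sup>2 - 1\<bar>"
    proof (rule growth[OF True])
      have "(norm w)\<^sup>2 < 1" using True by (simp add: power_less_one_iff)
      then show "0 < \<bar>(norm w)\<^sup>2 - 1\<bar>" by simp
      have "1 - (norm w)\<^sup>2 = (1 + norm w) * (1 - norm w)" by (simp add: algebra_simps power2_eq_square)
      also have "\<dots> \<le> 2 * (1 - norm w)" using True by (intro mult_right_mono) auto
      finally show "\<bar>(norm w)\<^sup>2 - 1\<bar> \<le> 2 * (max 1 (norm w))\<^sup>2 * (1 - norm w)"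
        using True \<open>(norm w)\<^sup>2 < 1\<close> by (simp add: max_def)
    qed auto
    ultimately show ?thesis using r by (intro that[of "exp (g w)" 0]) auto
  next
    case False
    then have w: "1 < norm w" "w \<noteq> 0" using assms by auto
    define m where "m = norm w"
    define \<zeta> where "\<zeta> = reflect w"
    have m: "1 < m" using w by (simp add: m_def)
    have n\<zeta>: "norm \<zeta> = 1 / m" by (simp add: \<zeta>_def m_def norm_reflect)
    then have \<zeta>: "norm \<zeta> < 1" using m by simp
    define c where "c = - 1 / (cnj w)\<^sup>2"
    have refl': "(reflect has_derivative (\<lambda>v. c * cnj v)) (at w)"
    proof -
      have "((\<lambda>w. cnj (inverse w)) has_derivative (\<lambda>v. cnj (- (inverse w * v * inverse w)))) (at w)"
        using has_derivative_cnj[OF has_derivative_inverse'[OF w(2)]] by simp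
      moreover have "(\<lambda>w. cnj (inverse w)) = reflect"
        by (auto simp: reflect_def inverse_eq_divide)
      moreover have "(\<lambda>v. cnj (- (inverse w * v * inverse w))) = (\<lambda>v. c * cnj v)"
        by (simp add: fun_eq_iff c_def power2_eq_square inverse_eq_divide)
      ultimately show ?thesis by simp
    qed
    define E where "E = exp (g \<zeta>)"
    have f': "((\<lambda>w. f (reflect w)) has_derivative (\<lambda>v. E * (c * cnj v))) (at w)"
      using has_derivative_compose[OF refl', of f "(*) E"] deriv_f[OF \<zeta>]
      by (simp add: has_field_derivative_def E_def \<zeta>_def)
    have "((\<lambda>z. exp (g z)) has_field_derivative E * g' \<zeta>) (at \<zeta>)"
      unfolding E_def by (rule DERIV_chain2[OF DERIV_exp deriv_g[OF \<zeta>]])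
    then have e': "((\<lambda>w. exp (g (reflect w))) has_derivative (\<lambda>v. E * g' \<zeta> * (c * cnj v))) (at w)"
      using has_derivative_compose[OF refl', of "\<lambda>z. exp (g z)" "(*) (E * g' \<zeta>)"]
      by (simp add: has_field_derivative_def \<zeta>_def)
    define b where "b = (w - \<zeta>) * (E * g' \<zeta>) * c"
    have "((\<lambda>w. f (reflect w) + (w - reflect w) * exp (g (reflect w))) has_derivative
        (\<lambda>v. E * (c * cnj v) + ((w - reflect w) * (E * g' \<zeta> * (c * cnj v)) + (v - c * cnj v) * exp (g (reflect w))))) (at w)"
      by (rule has_derivative_add[OF f' has_derivative_mult[OF has_derivative_diff[OF has_derivative_ident refl'] e']])
    also have "(\<lambda>v. E * (c * cnj v) + ((w - reflect w) * (E * g' \<zeta> * (c * cnj v)) + (v - c * cnj v) * exp (g (reflect w))))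
        = (\<lambda>v. E * v + b * cnj v)"
      by (simp add: fun_eq_iff b_def E_def \<zeta>_def algebra_simps)
    finally have "(F has_derivative (\<lambda>v. E * v + b * cnj v)) (at w)"
      by (rule has_derivative_transform_within_open[of _ _ _ _ "- cball 0 1"]) (use w in \<open>auto simp: F_outside\<close>)
    moreover have "norm b \<le> r * norm E"
    proof -
      have "norm c = 1 / m\<^sup>2" by (simp add: c_def norm_divide norm_power m_def)
      then have "norm b = (m\<^sup>2 - 1) / m * (norm E * norm (g' \<zeta>)) * (1 / m\<^sup>2)"
        using norm_minus_reflect(1)[of w] w by (simp add: b_def norm_mult \<zeta>_def m_def)
      also have "\<dots> = norm E * (norm (g' \<zeta>) * (1 - (norm \<zeta>)\<^sup>2)) * (1 / m)"
        using m by (simp add: n\<zeta> field_simps power2_eq_square)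
      also have "\<dots> \<le> norm E * r * 1"
        using bloch[OF \<zeta>] m r \<zeta> by (intro mult_mono) (auto simp: power_le_one)
      finally show ?thesis by (simp add: mult.commute)
    qed
    moreover have "norm E \<le> 2 * max 1 (norm w) / sqrt \<bar>(norm w)\<^sup>2 - 1\<bar>"
      unfolding E_def
    proof (rule growth[OF \<zeta>])
      have m2: "1 < m\<^sup>2" using m by simp
      then show "0 < \<bar>(norm w)\<^sup>2 - 1\<bar>" by (simp add: m_def)
      have "m\<^sup>2 - 1 = (m + 1) * (m - 1)" by (simp add: algebra_simps power2_eq_square)
      also have "\<dots> \<le> (2 * m) * (m - 1)" using m by (intro mult_right_mono) auto
      also have "\<dots> = 2 * m\<^sup>2 * (1 - 1 / m)" using m by (simp add: field_simps power2_eq_square)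
      finally show "\<bar>(norm w)\<^sup>2 - 1\<bar> \<le> 2 * (max 1 (norm w))\<^sup>2 * (1 - norm \<zeta>)"
        using m m2 by (simp add: n\<zeta> m_def[symmetric] max_def)
    qed auto
    ultimately show ?thesis by (rule that)
  qed
qed

text \<open>On the horizontal line at height \<open>y\<close> the singularity is that of
  \<open>1 / sqrt \<bar>x\<^sup>2 - (1 - y\<^sup>2)\<bar>\<close>, so the square root criterion
  applies with \<open>c = 1 - y\<^sup>2\<close>. This \<open>c\<close> is 0 only on the two tangents
  \<open>y = 1\<close> and \<open>y = - 1\<close>, a null set of lines. Vertical lines are
  symmetric.\<close>

lemma ACL_F: "ACL_on UNIV F"
  unfolding ACL_on_def
proof (intro allI impI conjI)
  fix a b :: complex
  obtain R where R: "1 \<le> R" "\<And>w. w \<in> cbox a b \<Longrightarrow> norm w \<le> R"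
  proof -
    obtain R0 where "\<And>w. w \<in> cbox a b \<Longrightarrow> norm w \<le> R0"
      using bounded_cbox[of a b] unfolding bounded_iff by blast
    then show thesis by (intro that[of "max 1 R0"]) force+
  qed
  have bnd: "norm (F' :: complex) \<le> 4 * R / sqrt Q"
    if "0 \<le> Q" "norm F' \<le> norm a' + norm b'" "norm b' \<le> r * norm a'"
      "norm a' \<le> 2 * max 1 (norm w) / sqrt Q" "w \<in> cbox a b" for F' a' b' :: complex and w Q
  proof -
    have "norm F' \<le> norm a' + r * norm a'" using that by linarith
    also have "\<dots> \<le> 2 * norm a'" using r mult_right_mono[of r 1 "norm a'"] by simp
    also have "\<dots> \<le> 2 * (2 * max 1 (norm w) / sqrt Q)" using that by simp
    also have "\<dots> = 4 * max 1 (norm w) / sqrt Q" by simp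
    also have "\<dots> \<le> 4 * R / sqrt Q"
      using R that(1,5) by (intro divide_right_mono) auto
    finally show ?thesis .
  qed
  have null: "AE t in lebesgue. (t::real)\<^sup>2 \<noteq> 1"
  proof -
    have "{1, - 1 :: real} \<in> null_sets lebesgue"
      using negligible_iff_null_sets negligible_finite by blast
    then have "AE t in lebesgue. t \<notin> {1, - 1 :: real}" by (rule AE_not_in)
    then show ?thesis by eventually_elim (auto simp: power2_eq_1_iff)
  qed
  show "AE y in lebesgue. y \<in> {Im a..Im b} \<longrightarrow>
      absolutely_continuous_on_interval (Re a) (Re b) (\<lambda>x. F (Complex x y))"
    using null
  proof eventually_elim
    case (elim y)
    show ?case
    proof
      assume y: "y \<in> {Im a..Im b}"
      define G where "G = (\<lambda>x. F (Complex x y))"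
      have derivs: "(G has_vector_derivative vector_derivative G (at x)) (at x)
          \<and> norm (vector_derivative G (at x)) \<le> 4 * R / sqrt \<bar>x\<^sup>2 - (1 - y\<^sup>2)\<bar>"
        if x: "x \<in> {Re a..Re b}" "x\<^sup>2 \<noteq> 1 - y\<^sup>2" for x
      proof -
        define w where "w = Complex x y"
        have w: "w \<in> cbox a b" using x y by (simp add: w_def in_cbox_complex_iff)
        have n: "(norm w)\<^sup>2 = x\<^sup>2 + y\<^sup>2" by (simp add: w_def cmod_power2)
        then have "norm w \<noteq> 1" using x by auto
        then obtain \<alpha> \<beta> where \<alpha>\<beta>: "(F has_derivative (\<lambda>v. \<alpha> * v + \<beta> * cnj v)) (at w)" "norm \<beta> \<le> r * norm \<alpha>"
          "norm \<alpha> \<le> 2 * max 1 (norm w) / sqrt \<bar>(norm w)\<^sup>2 - 1\<bar>"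
          by (rule F_has_derivative)
        have "(G has_vector_derivative \<alpha> + \<beta>) (at x)"
          using partials_at(4)[OF \<alpha>\<beta>(1)] by (simp add: w_def G_def)
        moreover have "norm (\<alpha> + \<beta>) \<le> 4 * R / sqrt \<bar>(norm w)\<^sup>2 - 1\<bar>"
          by (rule bnd[OF abs_ge_zero norm_triangle_ineq \<alpha>\<beta>(2,3) w])
        moreover have "(norm w)\<^sup>2 - 1 = x\<^sup>2 - (1 - y\<^sup>2)" using n by simp
        ultimately show ?thesis by (metis vector_derivative_at)
      qed
      show "absolutely_continuous_on_interval (Re a) (Re b) (\<lambda>x. F (Complex x y))"
        unfolding G_def[symmetric]
      proof (rule absolutely_continuous_on_interval_sqrt_singularity[where c = "1 - y\<^sup>2" and C = "4 * R"
            and G' = "\<lambda>t. vector_derivative G (at t)"])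
        show "continuous_on {Re a..Re b} G"
          unfolding G_def Complex_eq
          by (intro continuous_on_compose2[OF continuous_F] continuous_intros) auto
        show "1 - y\<^sup>2 \<noteq> 0" using elim by simp
        show "0 \<le> 4 * R" using R(1) by simp
      qed (use derivs in blast)+
    qed
  qed
  show "AE x in lebesgue. x \<in> {Re a..Re b} \<longrightarrow>
      absolutely_continuous_on_interval (Im a) (Im b) (\<lambda>y. F (Complex x y))"
    using null
  proof eventually_elim
    case (elim x)
    show ?case
    proof
      assume x: "x \<in> {Re a..Re b}"
      define G where "G = (\<lambda>y. F (Complex x y))"
      have derivs: "(G has_vector_derivative vector_derivative G (at y)) (at y)
          \<and> norm (vector_derivative G (at y)) \<le> 4 * R / sqrt \<bar>y\<^sup>2 - (1 - x\<^sup>2)\<bar>"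
        if y: "y \<in> {Im a..Im b}" "y\<^sup>2 \<noteq> 1 - x\<^sup>2" for y
      proof -
        define w where "w = Complex x y"
        have w: "w \<in> cbox a b" using x y by (simp add: w_def in_cbox_complex_iff)
        have n: "(norm w)\<^sup>2 = x\<^sup>2 + y\<^sup>2" by (simp add: w_def cmod_power2)
        then have "norm w \<noteq> 1" using y by auto
        then obtain \<alpha> \<beta> where \<alpha>\<beta>: "(F has_derivative (\<lambda>v. \<alpha> * v + \<beta> * cnj v)) (at w)" "norm \<beta> \<le> r * norm \<alpha>"
          "norm \<alpha> \<le> 2 * max 1 (norm w) / sqrt \<bar>(norm w)\<^sup>2 - 1\<bar>"
          by (rule F_has_derivative)
        have "(G has_vector_derivative \<i> * (\<alpha> - \<beta>)) (at y)"
          using partials_at(5)[OF \<alpha>\<beta>(1)] by (simp add: w_def G_def)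
        moreover have "norm (\<i> * (\<alpha> - \<beta>)) \<le> norm \<alpha> + norm \<beta>"
          using norm_triangle_ineq4[of \<alpha> \<beta>] by (simp add: norm_mult)
        then have "norm (\<i> * (\<alpha> - \<beta>)) \<le> 4 * R / sqrt \<bar>(norm w)\<^sup>2 - 1\<bar>"
          by (rule bnd[OF abs_ge_zero _ \<alpha>\<beta>(2,3) w])
        moreover have "(norm w)\<^sup>2 - 1 = y\<^sup>2 - (1 - x\<^sup>2)" using n by simp
        ultimately show ?thesis by (metis vector_derivative_at)
      qed
      show "absolutely_continuous_on_interval (Im a) (Im b) (\<lambda>y. F (Complex x y))"
        unfolding G_def[symmetric]
      proof (rule absolutely_continuous_on_interval_sqrt_singularity[where c = "1 - x\<^sup>2" and C = "4 * R"
            and G' = "\<lambda>t. vector_derivative G (at t)"])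
        show "continuous_on {Im a..Im b} G"
          unfolding G_def Complex_eq
          by (intro continuous_on_compose2[OF continuous_F] continuous_intros) auto
        show "1 - x\<^sup>2 \<noteq> 0" using elim by simp
        show "0 \<le> 4 * R" using R(1) by simp
      qed (use derivs in blast)+
    qed
  qed
qed

lemma quasiconformal_F: "quasiconformal UNIV UNIV F"
proof -
  have "sphere 0 1 \<in> null_sets (lebesgue :: complex measure)"
    using negligible_iff_null_sets negligible_sphere by blast
  then have "AE w in lebesgue. w \<notin> sphere (0 :: complex) 1" by (rule AE_not_in)
  then have dilatation: "AE w in lebesgue. w \<in> UNIV \<longrightarrow> has_partials_at F w \<and> norm (d_zbar F w) \<le> r * norm (d_z F w)"
  proof eventually_elim
    case (elim w)
    then have "norm w \<noteq> 1" by simp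
    then obtain a b where ab: "(F has_derivative (\<lambda>v. a * v + b * cnj v)) (at w)" "norm b \<le> r * norm a"
      by (rule F_has_derivative)
    then show ?case using partials_at(1-3)[OF ab(1)] by simp
  qed
  have "0 \<le> r" "r < 1" using r by auto
  with dilatation show ?thesis
    unfolding quasiconformal_def by (intro conjI exI[of _ r] open_UNIV homeomorphism_F ACL_F)
qed

end

section \<open>From the extension to the ball in the image\<close>

text \<open>Nothing is known about \<open>f\<close> on the circle, so Becker's extension is built
  from the continuous extension \<open>h\<close> of \<open>f\<close> to the closed disc. Univalence
  of \<open>f\<close> is then inherited from injectivity of \<open>F\<close>.\<close>

lemma (in bloch_primitive) restrict_in_D_tilde:
  assumes "f 0 = 0"
  shows "restrict f unit_disc \<in> D_tilde"
proof -
  obtain h where h: "uniformly_continuous_on (closure (ball 0 1)) h" "\<And>z. z \<in> ball 0 1 \<Longrightarrow> f z = h z"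
    by (rule uniformly_continuous_on_extension_on_closure[OF uniformly_continuous_on_disc]) (rule that)
  have hf: "h z = f z" if "norm z < 1" for z using h(2)[of z] that by simp
  have h': "(h has_field_derivative exp (g z)) (at z)" if "norm z < 1" for z
    using deriv_f[OF that] by (rule has_field_derivative_transform_within_open[of _ _ _ "ball 0 1"]) (use that in \<open>auto simp: hf\<close>)
  have d: "((restrict f unit_disc) has_field_derivative exp (g z)) (at z)" if "norm z < 1" for z
    using deriv_f[OF that] by (rule has_field_derivative_transform_within_open[of _ _ _ "ball 0 1"]) (use that in auto)
  interpret bloch_extension h g g' r
  proof
    show "continuous_on (cball 0 1) h"
      using uniformly_continuous_imp_continuous[OF h(1)] by simp
  qed (use r h' deriv_g bloch g_0 hf assms in auto)
  have F: "F z = f z" if "norm z < 1" for z using F_inside[of z] hf[of z] that by simp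
  have "inj_on (restrict f unit_disc) unit_disc"
  proof (rule inj_onI)
    fix x y assume "x \<in> unit_disc" "y \<in> unit_disc" "restrict f unit_disc x = restrict f unit_disc y"
    then have "F x = F y" using F by simp
    then show "x = y" using inj_F by (simp add: inj_eq)
  qed
  moreover have "restrict f unit_disc holomorphic_on unit_disc"
    unfolding holomorphic_on_open[OF open_ball] using d by (metis mem_ball_0)
  moreover have "deriv (restrict f unit_disc) 0 = 1" using DERIV_imp_deriv[OF d[of 0]] g_0 by simp
  ultimately show ?thesis
    unfolding D_tilde_def using quasiconformal_F F assms by auto
qed

theorem theoremA4:
  shows "\<exists>r>0. A_inf_ball r \<subseteq> theta ` D_tilde"
proof (intro exI conjI subsetI)
  show "(0::real) < 1 / 4000" by simp
  fix \<psi> assume \<psi>: "\<psi> \<in> A_inf_ball (1 / 4000)"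
  then have ext: "\<psi> \<in> extensional unit_disc" and hol: "\<psi> holomorphic_on unit_disc"
    and bdd: "bdd_above ((\<lambda>z. norm (\<psi> z * of_real (1 - (norm z)\<^sup>2))) ` unit_disc)"
    and norm: "A_inf_norm \<psi> < 1 / 4000"
    by (auto simp: A_inf_ball_def A_inf_def)
  obtain g0 where g0: "\<And>z. z \<in> unit_disc \<Longrightarrow> (g0 has_field_derivative \<psi> z) (at z within unit_disc)"
    using holomorphic_convex_primitive'[OF convex_ball open_ball hol] by blast
  \<comment> \<open>Normalising at 0 makes \<open>exp (g 0) = 1\<close>, the required derivative of
    \<open>f\<close> at 0.\<close>
  define g where "g z = g0 z - g0 0" for z
  have g: "(g has_field_derivative \<psi> z) (at z)" if "norm z < 1" for z
    unfolding g_def using g0[of z] that by (auto intro!: derivative_eq_intros simp: at_within_open[OF _ open_ball])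
  have "(\<lambda>z. exp (g z)) holomorphic_on unit_disc"
    using g by (intro holomorphic_intros) (metis holomorphic_on_open mem_ball_0 open_ball)
  then obtain f0 where f0: "\<And>z. z \<in> unit_disc \<Longrightarrow> (f0 has_field_derivative exp (g z)) (at z within unit_disc)"
    using holomorphic_convex_primitive'[OF convex_ball open_ball] by blast
  define f where "f z = f0 z - f0 0" for z
  have f: "(f has_field_derivative exp (g z)) (at z)" if "norm z < 1" for z
    unfolding f_def using f0[of z] that by (auto intro!: derivative_eq_intros simp: at_within_open[OF _ open_ball])
  have bloch: "norm (\<psi> z) * (1 - (norm z)\<^sup>2) \<le> 1 / 4000" if "norm z < 1" for z
  proof -
    have "norm (\<psi> z * of_real (1 - (norm z)\<^sup>2)) \<le> A_inf_norm \<psi>"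
      unfolding A_inf_norm_def using that by (intro cSUP_upper[OF _ bdd]) auto
    moreover have "(norm z)\<^sup>2 \<le> 1" using that by (simp add: power_le_one)
    ultimately show ?thesis using norm by (simp add: norm_mult del: of_real_diff)
  qed
  interpret bloch_primitive f g \<psi> "1 / 4000"
    by unfold_locales (use f g bloch in \<open>auto simp: g_def\<close>)
  have "restrict f unit_disc \<in> D_tilde"
    by (rule restrict_in_D_tilde) (simp add: f_def)
  moreover have "theta (restrict f unit_disc) = \<psi>"
  proof
    fix z
    show "theta (restrict f unit_disc) z = \<psi> z"
    proof (cases "z \<in> unit_disc")
      case True
      have d1: "deriv (restrict f unit_disc) w = exp (g w)" if "w \<in> unit_disc" for w
      proof (rule DERIV_imp_deriv)
        show "((restrict f unit_disc) has_field_derivative exp (g w)) (at w)"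
          by (rule has_field_derivative_transform_within_open[OF f, of _ "ball 0 1"]) (use that in auto)
      qed
      have "((\<lambda>w. exp (g w)) has_field_derivative exp (g z) * \<psi> z) (at z)"
        using g[of z] True by (auto intro!: derivative_eq_intros)
      \<comment> \<open>\<open>deriv (restrict f unit_disc)\<close> is known to equal
        \<open>exp \<circ> g\<close> only on the open disc, which is enough to differentiate it
        again at \<open>z\<close>. The factor \<open>exp (g z)\<close> then cancels in the
        quotient.\<close>
      then have "(deriv (restrict f unit_disc) has_field_derivative exp (g z) * \<psi> z) (at z)"
        by (rule has_field_derivative_transform_within_open[of _ _ _ "ball 0 1"]) (use True d1 in auto)
      then have "deriv (deriv (restrict f unit_disc)) z = exp (g z) * \<psi> z" by (rule DERIV_imp_deriv)
      then show ?thesis using True d1[OF True] by (simp add: theta_def)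
    next
      case False
      \<comment> \<open>Off the disc both sides are \<open>undefined\<close>.\<close>
      then show ?thesis using ext by (simp add: theta_def extensional_def)
    qed
  qed
  ultimately show "\<psi> \<in> theta ` D_tilde" by (metis imageI)
qed

end
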